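(* Let $(M,F)$ be a complete Berwald manifold. Suppose that its flag curvature is nowhere vanishing, i.e. $K(y,\sigma)\neq 0$ for every $x\in M$ and every flag $(y,\sigma)$ at $x$. Then $(M,F)$ is Riemannian, i.e. there is a Riemannian metric $h$ on $M$ such that $F(x,y)=\sqrt{h_x(y,y)}$ for all $x\in M$ and $y\in T_xM$.
   Context: **Finsler manifold.** $M$ is an $n$-dimensional smooth manifold with local coordinates $(x^i)$ and induced coordinates $(x,y)$ on $TM$, where $y=y^i\frac{\partial}{\partial x^i}$. A (Riemann-)Finsler manifold $(M,F)$ is $M$ together with a function $F:TM\to[0,\infty)$ such that: (1) $F$ is smooth and positive on $\widetilde{TM}:=TM\setminus\{0\}$ (the tangent bundle without its zero section); (2) $F(x,\lambda y)=\lambda F(x,y)$ for all $\lambda>0$ and $(x,y)\in TM$ (symmetry $F(x,-y)=F(x,y)$ is not assumed); (3) the matrix $g_{ij}(x,y):=\frac12\frac{\partial^2F^2}{\partial y^i\partial y^j}$ is positive definite on $\widetilde{TM}$. Let $(g^{ij})$ denote the inverse matrix of $(g_{ij})$. **Chern connection.** Put $\gamma^i_{jk}:=\frac12 g^{is}\left(\frac{\partial g_{js}}{\partial x^k}+\frac{\partial g_{ks}}{\partial x^j}-\frac{\partial g_{jk}}{\partial x^s}\right)$, $G^i:=\gamma^i_{jk}y^jy^k$, $N^i_j:=\frac12\frac{\partial G^i}{\partial y^j}$, and $\frac{\delta}{\delta x^k}:=\frac{\partial}{\partial x^k}-N^j_k\frac{\partial}{\partial y^j}$. The Chern connection coefficients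 are the following functions on $\widetilde{TM}$: $$\Gamma^i_{jk}(x,y)=\frac12 g^{is}\left(\frac{\delta g_{js}}{\delta x^k}+\frac{\delta g_{ks}}{\delta x^j}-\frac{\delta g_{jk}}{\delta x^s}\right).$$ **Berwald manifold.** $(M,F)$ is a Berwald manifold (Berwald space) if, in every local coordinate system, the coefficients $\Gamma^i_{jk}(x,y)$ do not depend on $y$, i.e. they are constant on each punctured tangent space $T_xM\setminus\{0\}$. **Flag curvature.** The curvature coefficients are $$R^{\ i}_{j\ kl}=\frac{\delta\Gamma^i_{jl}}{\delta x^k}-\frac{\delta\Gamma^i_{jk}}{\delta x^l}+\Gamma^i_{hk}\Gamma^h_{jl}-\Gamma^i_{hl}\Gamma^h_{jk},\qquad R_{jikl}:=g_{is}R^{\ s}_{j\ kl}.$$ A flag at $x\in M$ is a pair $(y,\sigma)$ where $\sigma\subset T_xM$ is a 2-dimensional linear subspace and $y\in\sigma$ is a non-zero vector. Its flag curvature is $$K(y,\sigma):=\frac{V^i\,(y^jR_{jikl}y^l)\,V^k}{g(y,y)g(V,V)-[g(y,V)]^2},$$ where $V=V^i\frac{\partial}{\partial x^i}\in\sigma$ is any vector linearly independent of $y$, and $g=(g_{ij}(x,y))$ and $R_{jikl}$ are evaluated at $(x,y)$. The value does not depend on the choice of $V$. **Completeness.** The geodesics of $(M,F)$ are the curves satisfying, in local coordinates, $\ddot c^{\,i}+\Gamma^i_{jk}(c,\dot c)\,\dot c^{\,j}\dot c^{\,k}=0$. For Berwald manifolds forward and backward completeness are equivalent. The manifold is called complete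 if every geodesic can be extended to be defined on all of $\mathbb{R}$.
   Formalization: The dimension of M is assumed to be at least 2; in dimension 1 there are no flags and the claim fails, e.g. F(x,y) = |y| + y/2 on the real line is complete and Berwald but not Riemannian. *)

theory Defs
  imports "HOL-Analysis.Analysis" "HOL-Library.Function_Algebras"
begin

section \<open>Smooth maps between open subsets of Euclidean spaces\<close>

text \<open>Meant for open \<open>S\<close> and a finite-dimensional domain, where being \<open>C^k\<close> is the same as
  having \<open>C^(k-1)\<close> directional derivatives.\<close>

primrec Ck_on :: "nat \<Rightarrow> 'a::real_normed_vector set \<Rightarrow> ('a \<Rightarrow> 'b::real_normed_vector) \<Rightarrow> bool" where
  "Ck_on 0 S f \<longleftrightarrow> continuous_on S f"
| "Ck_on (Suc k) S f \<longleftrightarrow> (\<forall>x\<in>S. f differentiable (at x)) \<and>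
     (\<forall>v. Ck_on k S (\<lambda>x. frechet_derivative f (at x) v))"

definition smooth_on :: "'a::real_normed_vector set \<Rightarrow> ('a \<Rightarrow> 'b::real_normed_vector) \<Rightarrow> bool" where
  "smooth_on S f \<longleftrightarrow> (\<forall>k. Ck_on k S f)"

section \<open>Smooth manifolds\<close>

text \<open>A manifold is a Hausdorff, second countable type together with a maximal smooth atlas. A chart
  is a domain with a coordinate map; the values of the map outside the domain are irrelevant.\<close>

type_synonym ('m, 'n) chart = "'m set \<times> ('m \<Rightarrow> real^'n)"

abbreviation cdom :: "('m, 'n::finite) chart \<Rightarrow> 'm set" where "cdom \<equiv> fst"
abbreviation cmap :: "('m, 'n::finite) chart \<Rightarrow> 'm \<Rightarrow> real^'n" where "cmap \<equiv> snd"
abbreviation cimg :: "('m, 'n::finite) chart \<Rightarrow> (real^'n) set" where "cimg c \<equiv> cmap c ` cdom c"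
abbreviation cinv :: "('m, 'n::finite) chart \<Rightarrow> real^'n \<Rightarrow> 'm" where
  "cinv c \<equiv> inv_into (cdom c) (cmap c)"

definition is_chart :: "('m::topological_space, 'n::finite) chart \<Rightarrow> bool" where
  "is_chart c \<longleftrightarrow> open (cdom c) \<and> open (cimg c) \<and>
     homeomorphism (cdom c) (cimg c) (cmap c) (cinv c)"

definition transition :: "('m, 'n::finite) chart \<Rightarrow> ('m, 'n) chart \<Rightarrow> real^'n \<Rightarrow> real^'n" where
  "transition c d = cmap d \<circ> cinv c"

definition compatible :: "('m, 'n::finite) chart \<Rightarrow> ('m, 'n) chart \<Rightarrow> bool" where
  "compatible c d \<longleftrightarrow>
     smooth_on (cmap c ` (cdom c \<inter> cdom d)) (transition c d) \<and>
     smooth_on (cmap d ` (cdom c \<inter> cdom d)) (transition d c)"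

definition smooth_structure :: "('m::topological_space, 'n::finite) chart set \<Rightarrow> bool" where
  "smooth_structure A \<longleftrightarrow>
     (\<forall>c\<in>A. is_chart c) \<and> (\<Union>c\<in>A. cdom c) = UNIV \<and>
     (\<forall>c\<in>A. \<forall>d\<in>A. compatible c d) \<and>
     (\<forall>c. is_chart c \<and> (\<forall>d\<in>A. compatible c d) \<longrightarrow> c \<in> A)"

section \<open>Tangent vectors\<close>

text \<open>A tangent vector at \<open>p\<close> is the family of its coordinate vectors in the charts around \<open>p\<close>, which
  transform by the differentials of the transition maps (and is \<open>0\<close> at all other charts). The vector
  space operations are pointwise.\<close>

instantiation "fun" :: (type, real_vector) real_vector
begin

definition scaleR_fun :: "real \<Rightarrow> ('a \<Rightarrow> 'b) \<Rightarrow> 'a \<Rightarrow> 'b" where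
  "scaleR_fun r f = (\<lambda>x. r *\<^sub>R f x)"

instance
  by standard (auto simp: scaleR_fun_def fun_eq_iff scaleR_add_right scaleR_add_left)

end

type_synonym ('m, 'n) tvec = "('m, 'n) chart \<Rightarrow> real^'n"

definition tangent_space :: "('m, 'n::finite) chart set \<Rightarrow> 'm \<Rightarrow> ('m, 'n) tvec set" where
  "tangent_space A p = {v.
     (\<forall>c. \<not> (c \<in> A \<and> p \<in> cdom c) \<longrightarrow> v c = 0) \<and>
     (\<forall>c\<in>A. \<forall>d\<in>A. p \<in> cdom c \<and> p \<in> cdom d \<longrightarrow>
        v d = frechet_derivative (transition c d) (at (cmap c p)) (v c))}"

text \<open>The tangent vector at \<open>p\<close> with coordinates \<open>y\<close> in the chart \<open>c\<close>, i.e. \<open>y^i \<partial>/\<partial>x^i\<close>.\<close>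

definition tvec_of ::
  "('m, 'n::finite) chart set \<Rightarrow> ('m, 'n) chart \<Rightarrow> 'm \<Rightarrow> real^'n \<Rightarrow> ('m, 'n) tvec" where
  "tvec_of A c p y = (\<lambda>d. if d \<in> A \<and> p \<in> cdom d
     then frechet_derivative (transition c d) (at (cmap c p)) y else 0)"

section \<open>Finsler geometry in local coordinates\<close>

text \<open>Here \<open>L x y\<close> is the coordinate expression of \<open>F\<close> in induced coordinates of \<open>TM\<close>. All objects
  are meaningful for \<open>y \<noteq> 0\<close> only.\<close>

definition dx :: "'n::finite \<Rightarrow> (real^'n \<Rightarrow> real^'n \<Rightarrow> real) \<Rightarrow> real^'n \<Rightarrow> real^'n \<Rightarrow> real" where
  "dx k f x y = frechet_derivative (\<lambda>x'. f x' y) (at x) (axis k 1)"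

definition dy :: "'n::finite \<Rightarrow> (real^'n \<Rightarrow> real^'n \<Rightarrow> real) \<Rightarrow> real^'n \<Rightarrow> real^'n \<Rightarrow> real" where
  "dy k f x y = frechet_derivative (\<lambda>y'. f x y') (at y) (axis k 1)"

context
  fixes L :: "real^'n \<Rightarrow> real^'n \<Rightarrow> real"
begin

definition fund :: "'n::finite \<Rightarrow> 'n \<Rightarrow> real^'n \<Rightarrow> real^'n \<Rightarrow> real" where
  "fund i j x y = 1/2 * dy i (dy j (\<lambda>x' y'. (L x' y')\<^sup>2)) x y"

definition fund_matrix :: "real^'n::finite \<Rightarrow> real^'n \<Rightarrow> real^'n^'n" where
  "fund_matrix x y = (\<chi> i j. fund i j x y)"

definition fund_inv :: "'n::finite \<Rightarrow> 'n \<Rightarrow> real^'n \<Rightarrow> real^'n \<Rightarrow> real" where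
  "fund_inv i j x y = matrix_inv (fund_matrix x y) $ i $ j"

definition formal_christoffel :: "'n::finite \<Rightarrow> 'n \<Rightarrow> 'n \<Rightarrow> real^'n \<Rightarrow> real^'n \<Rightarrow> real" where
  "formal_christoffel i j k x y = 1/2 * (\<Sum>s\<in>UNIV. fund_inv i s x y *
     (dx k (fund j s) x y + dx j (fund k s) x y - dx s (fund j k) x y))"

definition spray :: "'n::finite \<Rightarrow> real^'n \<Rightarrow> real^'n \<Rightarrow> real" where
  "spray i x y = (\<Sum>j\<in>UNIV. \<Sum>k\<in>UNIV. formal_christoffel i j k x y * y $ j * y $ k)"

text \<open>\<open>N^i_j\<close>\<close>

definition nonlin_conn :: "'n::finite \<Rightarrow> 'n \<Rightarrow> real^'n \<Rightarrow> real^'n \<Rightarrow> real" where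
  "nonlin_conn i j x y = 1/2 * dy j (spray i) x y"

text \<open>\<open>\<delta>f/\<delta>x^k\<close>\<close>

definition hderiv ::
  "'n::finite \<Rightarrow> (real^'n \<Rightarrow> real^'n \<Rightarrow> real) \<Rightarrow> real^'n \<Rightarrow> real^'n \<Rightarrow> real" where
  "hderiv k f x y = dx k f x y - (\<Sum>j\<in>UNIV. nonlin_conn j k x y * dy j f x y)"

text \<open>\<open>\<Gamma>^i_jk\<close>\<close>

definition chern :: "'n::finite \<Rightarrow> 'n \<Rightarrow> 'n \<Rightarrow> real^'n \<Rightarrow> real^'n \<Rightarrow> real" where
  "chern i j k x y = 1/2 * (\<Sum>s\<in>UNIV. fund_inv i s x y *
     (hderiv k (fund j s) x y + hderiv j (fund k s) x y - hderiv s (fund j k) x y))"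

text \<open>\<open>curv_up j i k l\<close> is \<open>R_j^i_kl\<close>, and \<open>curv_low j i k l\<close> is \<open>R_jikl\<close>.\<close>

definition curv_up :: "'n::finite \<Rightarrow> 'n \<Rightarrow> 'n \<Rightarrow> 'n \<Rightarrow> real^'n \<Rightarrow> real^'n \<Rightarrow> real" where
  "curv_up j i k l x y = hderiv k (chern i j l) x y - hderiv l (chern i j k) x y
     + (\<Sum>h\<in>UNIV. chern i h k x y * chern h j l x y)
     - (\<Sum>h\<in>UNIV. chern i h l x y * chern h j k x y)"

definition curv_low :: "'n::finite \<Rightarrow> 'n \<Rightarrow> 'n \<Rightarrow> 'n \<Rightarrow> real^'n \<Rightarrow> real^'n \<Rightarrow> real" where
  "curv_low j i k l x y = (\<Sum>s\<in>UNIV. fund i s x y * curv_up j s k l x y)"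

text \<open>\<open>g(u, v)\<close> for the inner product \<open>g = (g_ij(x,y))\<close>\<close>

definition fund_form :: "real^'n::finite \<Rightarrow> real^'n \<Rightarrow> real^'n \<Rightarrow> real^'n \<Rightarrow> real" where
  "fund_form x y u v = (\<Sum>i\<in>UNIV. \<Sum>j\<in>UNIV. fund i j x y * u $ i * v $ j)"

definition flag_curv_coord :: "real^'n::finite \<Rightarrow> real^'n \<Rightarrow> real^'n \<Rightarrow> real" where
  "flag_curv_coord x y V =
     (\<Sum>i\<in>UNIV. \<Sum>j\<in>UNIV. \<Sum>k\<in>UNIV. \<Sum>l\<in>UNIV.
        V $ i * (y $ j * curv_low j i k l x y * y $ l) * V $ k)
     / (fund_form x y y y * fund_form x y V V - (fund_form x y y V)\<^sup>2)"

end

section \<open>Finsler and Berwald manifolds\<close>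

definition coord_expr :: "('m, 'n::finite) chart set \<Rightarrow> ('m \<Rightarrow> ('m, 'n) tvec \<Rightarrow> real) \<Rightarrow>
    ('m, 'n) chart \<Rightarrow> real^'n \<Rightarrow> real^'n \<Rightarrow> real" where
  "coord_expr A F c x y = F (cinv c x) (tvec_of A c (cinv c x) y)"

text \<open>Only the values \<open>F p v\<close> with \<open>v \<in> tangent_space A p\<close> matter.\<close>

definition finsler_manifold ::
  "('m::{t2_space, second_countable_topology}, 'n::finite) chart set \<Rightarrow>
     ('m \<Rightarrow> ('m, 'n) tvec \<Rightarrow> real) \<Rightarrow> bool" where
  "finsler_manifold A F \<longleftrightarrow> smooth_structure A \<and>
     (\<forall>p. \<forall>v\<in>tangent_space A p. F p v \<ge> 0) \<and>
     (\<forall>c\<in>A. smooth_on (cimg c \<times> (- {0})) (\<lambda>(x, y). coord_expr A F c x y)) \<and>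
     (\<forall>p. \<forall>v\<in>tangent_space A p. v \<noteq> 0 \<longrightarrow> F p v > 0) \<and>
     (\<forall>p. \<forall>v\<in>tangent_space A p. \<forall>r>0. F p (r *\<^sub>R v) = r * F p v) \<and>
     (\<forall>c\<in>A. \<forall>x\<in>cimg c. \<forall>y. y \<noteq> 0 \<longrightarrow>
        (\<forall>u. u \<noteq> 0 \<longrightarrow> u \<bullet> (fund_matrix (coord_expr A F c) x y *v u) > 0))"

definition berwald_manifold ::
  "('m::{t2_space, second_countable_topology}, 'n::finite) chart set \<Rightarrow>
     ('m \<Rightarrow> ('m, 'n) tvec \<Rightarrow> real) \<Rightarrow> bool" where
  "berwald_manifold A F \<longleftrightarrow> finsler_manifold A F \<and>
     (\<forall>c\<in>A. \<forall>x\<in>cimg c. \<forall>y z. y \<noteq> 0 \<and> z \<noteq> 0 \<longrightarrow>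
        (\<forall>i j k. chern (coord_expr A F c) i j k x y = chern (coord_expr A F c) i j k x z))"

definition is_flag :: "('m, 'n::finite) chart set \<Rightarrow> 'm \<Rightarrow>
    ('m, 'n) tvec \<Rightarrow> ('m, 'n) tvec set \<Rightarrow> bool" where
  "is_flag A p y \<sigma> \<longleftrightarrow>
     subspace \<sigma> \<and> dim \<sigma> = 2 \<and> \<sigma> \<subseteq> tangent_space A p \<and> y \<in> \<sigma> \<and> y \<noteq> 0"

text \<open>The value does not depend on the chosen chart \<open>c\<close> at \<open>p\<close>, nor on the chosen vector \<open>V\<close>.\<close>

definition flag_curvature :: "('m, 'n::finite) chart set \<Rightarrow> ('m \<Rightarrow> ('m, 'n) tvec \<Rightarrow> real) \<Rightarrow>
    'm \<Rightarrow> ('m, 'n) tvec \<Rightarrow> ('m, 'n) tvec set \<Rightarrow> real" where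
  "flag_curvature A F p y \<sigma> =
     (let c = (SOME c. c \<in> A \<and> p \<in> cdom c); V = (SOME V. V \<in> \<sigma> \<and> V \<notin> span {y})
      in flag_curv_coord (coord_expr A F c) (cmap c p) (y c) (V c))"

text \<open>At instants with zero velocity the right-hand side of the equation is \<open>0\<close> whatever \<open>chern\<close>
  yields there, so constant curves are geodesics.\<close>

definition geodesic_on :: "('m::topological_space, 'n::finite) chart set \<Rightarrow>
    ('m \<Rightarrow> ('m, 'n) tvec \<Rightarrow> real) \<Rightarrow> real set \<Rightarrow> (real \<Rightarrow> 'm) \<Rightarrow> bool" where
  "geodesic_on A F I \<gamma> \<longleftrightarrow> continuous_on I \<gamma> \<and>
     (\<forall>c\<in>A. \<forall>t\<in>I. \<gamma> t \<in> cdom c \<longrightarrow>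
        (let u = cmap c \<circ> \<gamma>; u' = (\<lambda>s. vector_derivative u (at s))
         in u differentiable (at t) \<and>
            (u' has_vector_derivative
               (\<chi> i. - (\<Sum>j\<in>UNIV. \<Sum>k\<in>UNIV.
                  chern (coord_expr A F c) i j k (u t) (u' t) * u' t $ j * u' t $ k))) (at t)))"

definition geodesically_complete :: "('m::topological_space, 'n::finite) chart set \<Rightarrow>
    ('m \<Rightarrow> ('m, 'n) tvec \<Rightarrow> real) \<Rightarrow> bool" where
  "geodesically_complete A F \<longleftrightarrow>
     (\<forall>I \<gamma>. open I \<and> is_interval I \<and> I \<noteq> {} \<and> geodesic_on A F I \<gamma> \<longrightarrow>
        (\<exists>\<gamma>'. geodesic_on A F UNIV \<gamma>' \<and> (\<forall>t\<in>I. \<gamma>' t = \<gamma> t)))"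

definition riemannian_metric :: "('m, 'n::finite) chart set \<Rightarrow>
    ('m \<Rightarrow> ('m, 'n) tvec \<Rightarrow> ('m, 'n) tvec \<Rightarrow> real) \<Rightarrow> bool" where
  "riemannian_metric A h \<longleftrightarrow>
     (\<forall>p. \<forall>u\<in>tangent_space A p. \<forall>v\<in>tangent_space A p. \<forall>w\<in>tangent_space A p. \<forall>a b.
        h p (a *\<^sub>R u + b *\<^sub>R v) w = a * h p u w + b * h p v w) \<and>
     (\<forall>p. \<forall>u\<in>tangent_space A p. \<forall>v\<in>tangent_space A p. h p u v = h p v u) \<and>
     (\<forall>p. \<forall>v\<in>tangent_space A p. v \<noteq> 0 \<longrightarrow> h p v v > 0) \<and>
     (\<forall>c\<in>A. \<forall>i j. smooth_on (cimg c) (\<lambda>x.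
        h (cinv c x) (tvec_of A c (cinv c x) (axis i 1)) (tvec_of A c (cinv c x) (axis j 1))))"

end

(* At each point x the curvature operators R(u, v) of the (y-independent) Chern connection are linear vector fields
   on the tangent space that annihilate E = F(x, .)^2, because the norm is parallel: delta E / delta x^k = 0, and
   commuting two horizontal derivatives leaves R^r_s(y^s) dE/dy^r = 0. If no flag curvature vanishes, the map
   V |-> R(V, y) y has kernel span {y}; together with the radial direction these operators therefore span every
   tangent space of T_xM - {0}. The second moments of the unit ball of E give an inner product q that the same
   operators preserve. Hence q / E is locally constant on the connected set T_xM - {0}, so E is a quadratic form. *)

theory Submission
  imports Defs
begin

section \<open>Smooth functions\<close>

text \<open>No group is integrated from the curvature operators and nothing is averaged over one.
  That a field \<open>A\<close> preserves the second moments is extracted at first order: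
  \<open>1 + t A\<close> maps the unit ball of \<open>E\<close> to a set squeezed between two scaled
  unit balls with factors \<open>1 - c t^2\<close> and \<open>1 + c t^2\<close>, which controls the
  determinant and the moments at once, and a differentiable function of \<open>t\<close> with a
  minimum at \<open>t = 0\<close> has derivative zero there. The moments are an inner product on
  linear forms, so \<open>q\<close> is its inverse. A second obstacle is regularity. The curvature
  contains \<open>x\<close>-derivatives of the connection coefficients, which are themselves built
  from a matrix inverse and from \<open>y\<close>-derivatives of the spray. In the Berwald case they
  are recovered from the spray by polarization, and Cramer's rule makes the spray a quotient of
  determinants of differentiable entries. The metric itself is the polarization of
  \<open>F^2\<close>. It is independent of charts by construction and its smoothness comes from that
  of \<open>F\<close>; the curvature argument supplies only bilinearity, one point at a
  time.\<close>

lemma Ck_on_cong: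
  assumes "open S" "\<And>x. x \<in> S \<Longrightarrow> f x = g x" "Ck_on k S f"
  shows "Ck_on k S g"
  using assms(2,3)
proof (induction k arbitrary: f g)
  case 0
  then show ?case using continuous_on_cong[of S S f g] by simp
next
  case (Suc k)
  have d: "(g has_derivative frechet_derivative f (at x)) (at x)" if "x \<in> S" for x
  proof (rule has_derivative_transform_within_open)
    show "(f has_derivative frechet_derivative f (at x)) (at x)"
      using Suc.prems(2) that unfolding Ck_on.simps frechet_derivative_works by blast
  qed (use assms(1) Suc.prems(1) that in auto)
  have eq: "frechet_derivative f (at x) = frechet_derivative g (at x)" if "x \<in> S" for x
    by (rule frechet_derivative_at[OF d[OF that]])
  have "Ck_on k S (\<lambda>x. frechet_derivative g (at x) v)" for v
    by (rule Suc.IH[of "\<lambda>x. frechet_derivative f (at x) v"]) (simp only: eq, use Suc.prems(2) in simp)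
  with d show ?case by (auto simp: differentiable_def)
qed

lemma Ck_on_Suc_imp: "Ck_on (Suc k) S f \<Longrightarrow> Ck_on k S f"
proof (induction k arbitrary: f)
  case 0
  then show ?case
    by (auto simp: continuous_on_eq_continuous_at intro!: continuous_at_imp_continuous_on differentiable_imp_continuous_within)
next
  case (Suc k)
  then have "Ck_on k S (\<lambda>x. frechet_derivative f (at x) v)" for v
    unfolding Ck_on.simps(2)[of "Suc k"] by blast
  with Suc.prems show ?case by auto
qed

lemma Ck_on_const: "Ck_on k S (\<lambda>x. c)"
  by (induction k arbitrary: c) auto

lemma Ck_on_add:
  assumes "open S" "Ck_on k S f" "Ck_on k S g"
  shows "Ck_on k S (\<lambda>x. f x + g x)"
  using assms(2,3)
proof (induction k arbitrary: f g)
  case 0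
  then show ?case by (auto intro: continuous_intros)
next
  case (Suc k)
  have d: "((\<lambda>x. f x + g x) has_derivative
      (\<lambda>v. frechet_derivative f (at x) v + frechet_derivative g (at x) v)) (at x)" if "x \<in> S" for x
    using Suc.prems that unfolding Ck_on.simps frechet_derivative_works by (intro has_derivative_add) blast+
  have "Ck_on k S (\<lambda>x. frechet_derivative (\<lambda>x. f x + g x) (at x) v)" for v
    by (rule Ck_on_cong[OF assms(1), where f = "\<lambda>x. frechet_derivative f (at x) v + frechet_derivative g (at x) v"])
      (use Suc frechet_derivative_at[OF d, symmetric] in auto)
  with d show ?case by (auto simp: differentiable_def)
qed

lemma Ck_on_mult:
  fixes f g :: "'a::real_normed_vector \<Rightarrow> real"
  assumes "open S" "Ck_on k S f" "Ck_on k S g"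
  shows "Ck_on k S (\<lambda>x. f x * g x)"
  using assms(2,3)
proof (induction k arbitrary: f g)
  case 0
  then show ?case by (auto intro: continuous_intros)
next
  case (Suc k)
  have d: "((\<lambda>x. f x * g x) has_derivative
      (\<lambda>v. f x * frechet_derivative g (at x) v + frechet_derivative f (at x) v * g x)) (at x)"
    if "x \<in> S" for x
    using Suc.prems that unfolding Ck_on.simps frechet_derivative_works by (intro has_derivative_mult) blast+
  have "Ck_on k S (\<lambda>x. frechet_derivative (\<lambda>x. f x * g x) (at x) v)" for v
    by (rule Ck_on_cong[OF assms(1),
        where f = "\<lambda>x. f x * frechet_derivative g (at x) v + frechet_derivative f (at x) v * g x"])
      (use Suc.prems Ck_on_Suc_imp[OF Suc.prems(1)] Ck_on_Suc_imp[OF Suc.prems(2)]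
        frechet_derivative_at[OF d, symmetric] in \<open>auto intro!: Ck_on_add Suc.IH assms(1)\<close>)
  with d show ?case by (auto simp: differentiable_def)
qed

lemma smooth_on_cong:
  assumes "open S" "\<And>x. x \<in> S \<Longrightarrow> f x = g x" "smooth_on S f"
  shows "smooth_on S g"
  using assms Ck_on_cong unfolding smooth_on_def by blast

lemma smooth_on_const: "smooth_on S (\<lambda>x. c)"
  by (simp add: smooth_on_def Ck_on_const)

lemma smooth_on_add: "open S \<Longrightarrow> smooth_on S f \<Longrightarrow> smooth_on S g \<Longrightarrow> smooth_on S (\<lambda>x. f x + g x)"
  by (simp add: smooth_on_def Ck_on_add)

lemma smooth_on_mult:
  fixes f g :: "'a::real_normed_vector \<Rightarrow> real"
  shows "open S \<Longrightarrow> smooth_on S f \<Longrightarrow> smooth_on S g \<Longrightarrow> smooth_on S (\<lambda>x. f x * g x)"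
  by (simp add: smooth_on_def Ck_on_mult)

lemma smooth_on_power2:
  fixes f :: "'a::real_normed_vector \<Rightarrow> real"
  shows "open S \<Longrightarrow> smooth_on S f \<Longrightarrow> smooth_on S (\<lambda>x. (f x)\<^sup>2)"
  by (simp add: power2_eq_square smooth_on_mult)

lemma smooth_on_differentiable: "smooth_on S f \<Longrightarrow> x \<in> S \<Longrightarrow> f differentiable (at x)"
  unfolding smooth_on_def by (metis Ck_on.simps(2))

lemma smooth_on_continuous: "smooth_on S f \<Longrightarrow> continuous_on S f"
  unfolding smooth_on_def by (metis Ck_on.simps(1))

lemma smooth_on_derivative: "smooth_on S f \<Longrightarrow> smooth_on S (\<lambda>x. frechet_derivative f (at x) v)"
  unfolding smooth_on_def by (metis Ck_on.simps(2))

text \<open>The derivative of a slice along \<open>v\<close> is the slice of the derivative along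
  \<open>(v, 0)\<close>, which is why the induction runs over all functions on the product. It makes
  the Finsler function smooth in \<open>x\<close> at a fixed nonzero coordinate vector.\<close>

lemma smooth_on_slice:
  fixes f :: "'a::real_normed_vector \<times> 'b::real_normed_vector \<Rightarrow> 'c::real_normed_vector"
  assumes "open S" "smooth_on (S \<times> T) f" "b \<in> T"
  shows "smooth_on S (\<lambda>x. f (x, b))"
proof -
  have "Ck_on k S (\<lambda>x. f (x, b))" if "Ck_on k (S \<times> T) f" for k and f :: "'a \<times> 'b \<Rightarrow> 'c"
    using that
  proof (induction k arbitrary: f)
    case 0
    then show ?case using assms(3)
      by (auto intro!: continuous_on_compose2[of "S \<times> T" f S "\<lambda>x. (x, b)"] continuous_on_Pair continuous_on_id continuous_on_const)
  next
    case (Suc k)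
    have d: "((\<lambda>x. f (x, b)) has_derivative (\<lambda>v. frechet_derivative f (at (x, b)) (v, 0))) (at x)"
      if "x \<in> S" for x
    proof (rule has_derivative_compose[of "\<lambda>x. (x, b)" "\<lambda>v. (v, 0)"])
      show "((\<lambda>x. (x, b)) has_derivative (\<lambda>v. (v, 0))) (at x)"
        by (intro has_derivative_Pair has_derivative_ident has_derivative_const)
      show "(f has_derivative frechet_derivative f (at (x, b))) (at (x, b))"
        using Suc.prems that assms(3) unfolding Ck_on.simps frechet_derivative_works by blast
    qed
    have "Ck_on k S (\<lambda>x. frechet_derivative (\<lambda>x. f (x, b)) (at x) v)" for v
      by (rule Ck_on_cong[OF assms(1), where f = "\<lambda>x. frechet_derivative f (at (x, b)) (v, 0)"])
        (use Suc.prems frechet_derivative_at[OF d, symmetric] in \<open>auto intro!: Suc.IH\<close>)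
    with d show ?case by (auto simp: differentiable_def)
  qed
  then show ?thesis using assms(2) by (simp add: smooth_on_def)
qed

section \<open>Symmetry of mixed second derivatives\<close>

lemma line_field_derivative:
  fixes f :: "'a::real_normed_vector \<Rightarrow> real"
  assumes "f differentiable at (z + r *\<^sub>R u)"
  shows "((\<lambda>s. f (z + s *\<^sub>R u)) has_field_derivative frechet_derivative f (at (z + r *\<^sub>R u)) u) (at r)"
proof -
  have "linear (frechet_derivative f (at (z + r *\<^sub>R u)))"
    using assms by (rule linear_frechet_derivative)
  moreover have "((\<lambda>s. f (z + s *\<^sub>R u)) has_derivative (\<lambda>h. frechet_derivative f (at (z + r *\<^sub>R u)) (h *\<^sub>R u))) (at r)"
  proof (rule has_derivative_compose[of "\<lambda>s. z + s *\<^sub>R u"])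
    show "((\<lambda>s. z + s *\<^sub>R u) has_derivative (\<lambda>h. h *\<^sub>R u)) (at r)"
      by (auto intro!: derivative_eq_intros)
    show "(f has_derivative frechet_derivative f (at (z + r *\<^sub>R u))) (at (z + r *\<^sub>R u))"
      using assms by (simp only: frechet_derivative_works)
  qed
  ultimately show ?thesis
    by (simp add: has_field_derivative_def linear_cmul mult_commute_abs)
qed

text \<open>The second difference on the left is symmetric in \<open>u\<close> and \<open>v\<close>, which forces the mixed derivatives to agree.\<close>

lemma second_difference_mean_value:
  fixes f :: "'a::real_normed_vector \<Rightarrow> real"
  assumes h: "h > 0"
    and S: "\<And>s t. 0 \<le> s \<Longrightarrow> s \<le> h \<Longrightarrow> 0 \<le> t \<Longrightarrow> t \<le> h \<Longrightarrow> z + s *\<^sub>R u + t *\<^sub>R v \<in> S"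
    and f: "\<And>x. x \<in> S \<Longrightarrow> f differentiable at x"
    and fu: "\<And>x. x \<in> S \<Longrightarrow> (\<lambda>x. frechet_derivative f (at x) u) differentiable at x"
  obtains s t where "0 \<le> s" "s \<le> h" "0 \<le> t" "t \<le> h"
    "f (z + h *\<^sub>R u + h *\<^sub>R v) - f (z + h *\<^sub>R u) - f (z + h *\<^sub>R v) + f z =
     h\<^sup>2 * frechet_derivative (\<lambda>x. frechet_derivative f (at x) u) (at (z + s *\<^sub>R u + t *\<^sub>R v)) v"
proof -
  \<comment> \<open>Two one-dimensional mean value arguments: \<open>\<phi>\<close> turns the second
    difference into a first difference along \<open>u\<close>, and then the
    \<open>u\<close>-derivative is varied along \<open>v\<close> only.\<close>
  define \<phi> where "\<phi> s = f (z + h *\<^sub>R v + s *\<^sub>R u) - f (z + s *\<^sub>R u)" for s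
  have "(\<phi> has_field_derivative frechet_derivative f (at (z + h *\<^sub>R v + s *\<^sub>R u)) u
      - frechet_derivative f (at (z + s *\<^sub>R u)) u) (at s)" if "0 \<le> s" "s \<le> h" for s
    unfolding \<phi>_def
    using S[of s h] S[of s 0] that h
    by (intro DERIV_diff line_field_derivative f) (auto simp: algebra_simps)
  from MVT2[OF h this] obtain s where s: "0 < s" "s < h"
    "\<phi> h - \<phi> 0 = h * (frechet_derivative f (at (z + h *\<^sub>R v + s *\<^sub>R u)) u
      - frechet_derivative f (at (z + s *\<^sub>R u)) u)" by auto
  define \<psi> where "\<psi> t = frechet_derivative f (at (z + s *\<^sub>R u + t *\<^sub>R v)) u" for t
  have "(\<psi> has_field_derivative frechet_derivative (\<lambda>x. frechet_derivative f (at x) u)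
      (at (z + s *\<^sub>R u + t *\<^sub>R v)) v) (at t)" if "0 \<le> t" "t \<le> h" for t
    unfolding \<psi>_def using S[of s t] that s
    by (intro line_field_derivative[of "\<lambda>x. frechet_derivative f (at x) u"] fu) auto
  from MVT2[OF h this] obtain t where t: "0 < t" "t < h"
    "\<psi> h - \<psi> 0 = h * frechet_derivative (\<lambda>x. frechet_derivative f (at x) u)
      (at (z + s *\<^sub>R u + t *\<^sub>R v)) v" by auto
  have "\<phi> h - \<phi> 0 = h * (\<psi> h - \<psi> 0)"
    using s(3) by (simp add: \<psi>_def algebra_simps)
  then show ?thesis
    using that[of s t] s t by (simp add: \<phi>_def power2_eq_square algebra_simps)
qed

lemma mixed_derivatives_commute:
  fixes f :: "'a::real_normed_vector \<Rightarrow> real"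
  assumes "open S" "smooth_on S f" "z \<in> S"
  shows "frechet_derivative (\<lambda>x. frechet_derivative f (at x) u) (at z) v
       = frechet_derivative (\<lambda>x. frechet_derivative f (at x) v) (at z) u"
proof -
  define P where "P x = frechet_derivative (\<lambda>x. frechet_derivative f (at x) u) (at x) v" for x
  define Q where "Q x = frechet_derivative (\<lambda>x. frechet_derivative f (at x) v) (at x) u" for x
  have cont: "continuous_on S P" "continuous_on S Q"
    unfolding P_def Q_def by (intro smooth_on_continuous smooth_on_derivative assms)+
  have "\<bar>P z - Q z\<bar> < e" if "e > 0" for e
  proof -
    obtain d where d: "d > 0" "ball z d \<subseteq> S" "\<And>x. x \<in> ball z d \<Longrightarrow> \<bar>P x - P z\<bar> < e/2"
      "\<And>x. x \<in> ball z d \<Longrightarrow> \<bar>Q x - Q z\<bar> < e/2"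
    proof -
      obtain a where "a > 0" "ball z a \<subseteq> S" using assms(1,3) open_contains_ball by blast
      moreover obtain b where "b > 0" "\<And>x. x \<in> S \<Longrightarrow> dist x z < b \<Longrightarrow> \<bar>P x - P z\<bar> < e/2"
        using cont(1)[unfolded continuous_on_iff dist_real_def, rule_format, OF assms(3) half_gt_zero[OF \<open>e > 0\<close>]]
        by blast
      moreover obtain c where "c > 0" "\<And>x. x \<in> S \<Longrightarrow> dist x z < c \<Longrightarrow> \<bar>Q x - Q z\<bar> < e/2"
        using cont(2)[unfolded continuous_on_iff dist_real_def, rule_format, OF assms(3) half_gt_zero[OF \<open>e > 0\<close>]]
        by blast
      ultimately show ?thesis
        by (intro that[of "min a (min b c)"]) (auto simp: dist_commute subset_eq)
    qed
    \<comment> \<open>Small enough for the parallelogram spanned by \<open>h u\<close> and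
      \<open>h v\<close> to stay in the ball; the \<open>+ 1\<close> keeps the denominator positive
      if both vectors vanish.\<close>
    define h where "h = d / (2 * (norm u + norm v + 1))"
    have h: "h > 0" using d(1) by (simp add: h_def add_nonneg_pos)
    have "h * (norm u + norm v + 1) = d/2"
      unfolding h_def by (simp add: field_simps add_nonneg_eq_0_iff)
    then have hd: "h * norm u + h * norm v < d"
      using h d(1) by (simp add: algebra_simps)
    have ball: "z + s *\<^sub>R u + t *\<^sub>R v \<in> ball z d" if "0 \<le> s" "s \<le> h" "0 \<le> t" "t \<le> h" for s t
    proof -
      have "norm (s *\<^sub>R u + t *\<^sub>R v) \<le> s * norm u + t * norm v"
        using norm_triangle_ineq[of "s *\<^sub>R u" "t *\<^sub>R v"] that by simp
      also have "\<dots> \<le> h * norm u + h * norm v"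
        using that by (intro add_mono mult_right_mono) auto
      also have "\<dots> < d" by (rule hd)
      finally have "dist z (z + (s *\<^sub>R u + t *\<^sub>R v)) < d"
        by (metis add_diff_cancel_left' dist_norm norm_minus_commute)
      then show ?thesis by (simp add: add.assoc)
    qed
    have ball': "z + s *\<^sub>R v + t *\<^sub>R u \<in> ball z d" if "0 \<le> s" "s \<le> h" "0 \<le> t" "t \<le> h" for s t
      using ball[of t s] that by (simp only: add.commute add.left_commute add.assoc)
    have diff: "f differentiable at x" "(\<lambda>x. frechet_derivative f (at x) w) differentiable at x"
      if "x \<in> ball z d" for x w
      using that d(2) assms(2) by (auto intro!: smooth_on_differentiable smooth_on_derivative)
    obtain s t where st: "0 \<le> s" "s \<le> h" "0 \<le> t" "t \<le> h"
      "f (z + h *\<^sub>R u + h *\<^sub>R v) - f (z + h *\<^sub>R u) - f (z + h *\<^sub>R v) + f z = h\<^sup>2 * P (z + s *\<^sub>R u + t *\<^sub>R v)"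
      using second_difference_mean_value[of h z u v "ball z d" f, OF h ball diff] unfolding P_def by blast
    obtain s' t' where st': "0 \<le> s'" "s' \<le> h" "0 \<le> t'" "t' \<le> h"
      "f (z + h *\<^sub>R v + h *\<^sub>R u) - f (z + h *\<^sub>R v) - f (z + h *\<^sub>R u) + f z = h\<^sup>2 * Q (z + s' *\<^sub>R v + t' *\<^sub>R u)"
      using second_difference_mean_value[of h z v u "ball z d" f, OF h ball' diff] unfolding Q_def by blast
    \<comment> \<open>So \<open>P\<close> and \<open>Q\<close> share a value, at two possibly
      different points of the ball. That value is within \<open>e/2\<close> of both
      \<open>P z\<close> and \<open>Q z\<close>.\<close>
    have "h\<^sup>2 * P (z + s *\<^sub>R u + t *\<^sub>R v) = h\<^sup>2 * Q (z + s' *\<^sub>R v + t' *\<^sub>R u)"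
      using st(5) st'(5) by (simp add: algebra_simps)
    then have "P (z + s *\<^sub>R u + t *\<^sub>R v) = Q (z + s' *\<^sub>R v + t' *\<^sub>R u)"
      using h by simp
    then show ?thesis
      using d(3)[OF ball[OF st(1-4)]] d(4)[OF ball'[OF st'(1-4)]] by linarith
  qed
  from this[of "\<bar>P z - Q z\<bar>"] have "P z = Q z" by auto
  then show ?thesis by (simp add: P_def Q_def)
qed

section \<open>Squared norms preserved by a transitive family of linear fields\<close>

text \<open>\<open>E\<close> models the squared Finsler norm on one tangent space. It may be
  asymmetric, and it is differentiated only off the origin, where the Finsler function is
  smooth.\<close>

locale squared_norm =
  fixes E :: "'a::euclidean_space \<Rightarrow> real" and E' :: "'a \<Rightarrow> 'a \<Rightarrow> real"
  assumes hom: "r > 0 \<Longrightarrow> E (r *\<^sub>R y) = r\<^sup>2 * E y"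
    and pos: "y \<noteq> 0 \<Longrightarrow> E y > 0"
    and zero: "E 0 = 0"
    and der: "y \<noteq> 0 \<Longrightarrow> (E has_derivative E' y) (at y)"
    and der_cont: "continuous_on (- {0}) (\<lambda>y. E' y v)"
begin

lemma nonneg: "E y \<ge> 0"
  by (cases "y = 0") (auto simp: zero less_imp_le pos)

lemma linear_E': "y \<noteq> 0 \<Longrightarrow> linear (E' y)"
  using der has_derivative_linear by blast

lemma euler:
  assumes "y \<noteq> 0" shows "E' y y = 2 * E y"
proof -
  have "((\<lambda>r. E (r *\<^sub>R y)) has_derivative (\<lambda>h. E' y (h *\<^sub>R y))) (at 1)"
    by (rule has_derivative_compose[of "\<lambda>r. r *\<^sub>R y" "\<lambda>h. h *\<^sub>R y" 1])
      (use der[OF assms] in \<open>auto intro!: derivative_eq_intros\<close>)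
  moreover have "((\<lambda>r. r\<^sup>2 * E y) has_derivative (\<lambda>h. 2 * h * E y)) (at 1)"
    by (auto intro!: derivative_eq_intros)
  then have "((\<lambda>r. E (r *\<^sub>R y)) has_derivative (\<lambda>h. 2 * h * E y)) (at 1)"
    by (rule has_derivative_transform_within_open[of _ _ _ _ "{0<..}"]) (auto simp: hom)
  ultimately have "(\<lambda>h. E' y (h *\<^sub>R y)) = (\<lambda>h. 2 * h * E y)"
    by (rule has_derivative_unique)
  from fun_cong[OF this, of 1] show ?thesis by simp
qed

lemma continuous_E_punctured: "continuous_on (- {0}) E"
  by (intro continuous_at_imp_continuous_on ballI has_derivative_continuous) (auto intro: der)

text \<open>The constants are the extreme values of \<open>E\<close> on the Euclidean unit sphere;
  homogeneity carries the bounds to all vectors.\<close>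

lemma comparable:
  obtains m K where "m > 0" "K > 0" "\<And>y. m * (norm y)\<^sup>2 \<le> E y" "\<And>y. E y \<le> K * (norm y)\<^sup>2"
proof -
  have cont: "continuous_on (sphere 0 1) E"
    by (rule continuous_on_subset[OF continuous_E_punctured]) auto
  have ne: "sphere (0::'a) 1 \<noteq> {}" using sphere_eq_empty[of "0::'a" 1] by simp
  obtain p where p: "p \<in> sphere 0 1" "\<And>y. y \<in> sphere 0 1 \<Longrightarrow> E p \<le> E y"
    using continuous_attains_inf[OF compact_sphere ne cont] by blast
  obtain q where q: "q \<in> sphere 0 1" "\<And>y. y \<in> sphere 0 1 \<Longrightarrow> E y \<le> E q"
    using continuous_attains_sup[OF compact_sphere ne cont] by blast
  have *: "E y = (norm y)\<^sup>2 * E (y /\<^sub>R norm y)" "y /\<^sub>R norm y \<in> sphere 0 1" if "y \<noteq> 0" for y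
    using hom[of "norm y" "y /\<^sub>R norm y"] that by auto
  show ?thesis
  proof (rule that[of "E p" "E q"])
    have "p \<noteq> 0" "q \<noteq> 0" using p(1) q(1) by auto
    then show "E p > 0" "E q > 0" by (simp_all add: pos)
    fix y
    show "E p * (norm y)\<^sup>2 \<le> E y" "E y \<le> E q * (norm y)\<^sup>2"
      using p(2)[OF *(2)[of y]] q(2)[OF *(2)[of y]] *(1)[of y]
      by (cases "y = 0"; simp add: zero mult.commute mult_left_mono)+
  qed
qed

lemma continuous_E: "continuous_on UNIV E"
proof -
  obtain m K where K: "K > 0" "\<And>y. E y \<le> K * (norm y)\<^sup>2" using comparable by metis
  have "((\<lambda>y. K * (norm y)\<^sup>2) \<longlongrightarrow> 0) (at (0::'a))"
    by (auto intro!: tendsto_eq_intros)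
  then have "(E \<longlongrightarrow> 0) (at 0)"
    by (rule tendsto_sandwich[OF _ _ tendsto_const, rotated 2]) (auto simp: nonneg K)
  then have "isCont E 0" by (simp add: isCont_def zero)
  moreover have "isCont E y" if "y \<noteq> 0" for y
    using der[OF that] has_derivative_continuous by blast
  ultimately show ?thesis by (metis continuous_at_imp_continuous_on)
qed

text \<open>Moving a unit vector by at most \<open>1/2\<close> stays in this annulus, which is
  compact and avoids the origin. Continuity bounds \<open>E'\<close> on each basis vector there, and
  linearity does the rest.\<close>

lemma derivative_bounded_annulus:
  obtains C where "C > 0" "\<And>z v. 1/2 \<le> norm z \<Longrightarrow> norm z \<le> 3/2 \<Longrightarrow> \<bar>E' z v\<bar> \<le> C * norm v"
proof -
  define Z where "Z = {z::'a. 1/2 \<le> norm z \<and> norm z \<le> 3/2}"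
  have "Z = cball 0 (3/2) - ball 0 (1/2)" by (auto simp: Z_def)
  then have Z: "compact Z" "Z \<subseteq> - {0}" by (auto simp: compact_diff Z_def)
  have "\<exists>c. \<forall>z\<in>Z. \<bar>E' z b\<bar> \<le> c" for b
  proof -
    have "bounded ((\<lambda>z. E' z b) ` Z)"
      by (intro compact_imp_bounded compact_continuous_image continuous_on_subset[OF der_cont] Z)
    then show ?thesis by (auto simp: bounded_iff)
  qed
  then obtain c where c: "\<And>b z. z \<in> Z \<Longrightarrow> \<bar>E' z b\<bar> \<le> c b" by metis
  define C where "C = 1 + (\<Sum>b\<in>Basis. \<bar>c b\<bar>)"
  show ?thesis
  proof (rule that[of C])
    show "C > 0" by (simp add: C_def add_pos_nonneg sum_nonneg)
    fix z v :: 'a assume "1/2 \<le> norm z" "norm z \<le> 3/2"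
    then have z: "z \<in> Z" "z \<noteq> 0" by (auto simp: Z_def)
    interpret linear "E' z" by (rule linear_E'[OF z(2)])
    have "E' z v = E' z (\<Sum>b\<in>Basis. (v \<bullet> b) *\<^sub>R b)" by (simp add: euclidean_representation)
    also have "\<dots> = (\<Sum>b\<in>Basis. (v \<bullet> b) * E' z b)" by (simp add: sum scale)
    finally have "\<bar>E' z v\<bar> \<le> (\<Sum>b\<in>Basis. \<bar>v \<bullet> b\<bar> * \<bar>E' z b\<bar>)"
      by (metis (no_types, lifting) abs_mult sum.cong sum_abs)
    also have "\<dots> \<le> (\<Sum>b\<in>Basis. norm v * \<bar>c b\<bar>)"
      using c[OF z(1)] by (intro sum_mono mult_mono Basis_le_norm) (auto intro: order_trans[OF _ abs_ge_self])
    also have "\<dots> \<le> C * norm v"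
      by (simp add: C_def algebra_simps flip: sum_distrib_left)
    finally show "\<bar>E' z v\<bar> \<le> C * norm v" .
  qed
qed

text \<open>Along \<open>s \<mapsto> z = y + s A y\<close> the derivative is \<open>E'(z) (A y) = E'(z) (A z) - s E'(z) (A (A y))\<close>, and the
  first term vanishes; so the linear map \<open>1 + t A\<close> preserves \<open>E\<close> up to second order in \<open>t\<close>.\<close>

lemma almost_invariant:
  assumes A: "linear A" "\<And>z. z \<noteq> 0 \<Longrightarrow> E' z (A z) = 0"
  obtains c d where "c > 0" "d > 0" "\<And>t y. \<bar>t\<bar> \<le> d \<Longrightarrow> \<bar>E (y + t *\<^sub>R A y) - E y\<bar> \<le> c * t\<^sup>2 * E y"
    "\<And>t y. \<bar>t\<bar> \<le> d \<Longrightarrow> norm (t *\<^sub>R A y) \<le> norm y / 2"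
proof -
  obtain a where a: "a > 0" "\<And>y. norm (A y) \<le> a * norm y"
    using linear_bounded_pos[OF A(1)] by blast
  obtain m K where m: "m > 0" "\<And>y. m * (norm y)\<^sup>2 \<le> E y" using comparable by metis
  obtain C where C: "C > 0" "\<And>z v. 1/2 \<le> norm z \<Longrightarrow> norm z \<le> 3/2 \<Longrightarrow> \<bar>E' z v\<bar> \<le> C * norm v"
    using derivative_bounded_annulus by blast
  \<comment> \<open>With this \<open>d\<close> the displacement \<open>t A y\<close> has at most
    half the length of \<open>y\<close>, so for a unit vector the whole segment stays in the
    annulus.\<close>
  define d where "d = 1 / (2 * a)"
  have small: "norm (t *\<^sub>R A y) \<le> norm y / 2" if "\<bar>t\<bar> \<le> d" for t y
  proof -
    have "norm (t *\<^sub>R A y) \<le> d * (a * norm y)"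
      using that a by (auto intro!: mult_mono)
    then show ?thesis using a(1) by (simp add: d_def)
  qed
  have unit: "\<bar>E (y + t *\<^sub>R A y) - E y\<bar> \<le> C * a\<^sup>2 * t\<^sup>2" if t: "\<bar>t\<bar> \<le> d" and y: "norm y = 1" for t y
  proof -
    define z where "z s = y + s *\<^sub>R A y" for s
    have z: "1/2 \<le> norm (z s)" "norm (z s) \<le> 3/2" "z s \<noteq> 0" if "\<bar>s\<bar> \<le> d" for s
      using small[OF that, of y] y norm_triangle_ineq[of y "s *\<^sub>R A y"] norm_triangle_ineq2[of y "- s *\<^sub>R A y"]
      by (auto simp: z_def)
    have bound: "\<bar>E' (z s) (A y)\<bar> \<le> C * a\<^sup>2 * \<bar>t\<bar>" if s: "\<bar>s\<bar> \<le> \<bar>t\<bar>" for s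
    proof -
      have sd: "\<bar>s\<bar> \<le> d" using s t by linarith
      interpret A: linear A by (rule A(1))
      interpret E: linear "E' (z s)" by (rule linear_E'[OF z(3)[OF sd]])
      have "A (z s) = A y + s *\<^sub>R A (A y)" by (simp add: z_def A.add A.scale)
      then have "E' (z s) (A (z s)) = E' (z s) (A y) + s * E' (z s) (A (A y))"
        by (simp add: E.add E.scale)
      then have "\<bar>E' (z s) (A y)\<bar> = \<bar>s\<bar> * \<bar>E' (z s) (A (A y))\<bar>"
        using A(2)[OF z(3)[OF sd]] by (metis abs_minus_cancel abs_mult add_eq_0_iff)
      also have "\<dots> \<le> \<bar>t\<bar> * (C * norm (A (A y)))"
        using s C(2)[OF z(1,2)[OF sd], of "A (A y)"] by (intro mult_mono) auto
      also have "norm (A (A y)) \<le> a * (a * norm y)"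
        using a(2)[of "A y"] a(2)[of y] a(1) by (meson mult_left_mono less_imp_le order_trans)
      then have "\<bar>t\<bar> * (C * norm (A (A y))) \<le> \<bar>t\<bar> * (C * (a * (a * norm y)))"
        using C(1) by (intro mult_left_mono) auto
      finally show ?thesis using y by (simp add: power2_eq_square algebra_simps)
    qed
    \<comment> \<open>The derivative along the segment is of order \<open>t\<close>; over a segment
      of length \<open>t\<close> this makes the change quadratic.\<close>
    have "norm (E (z t) - E (z 0)) \<le> C * a\<^sup>2 * \<bar>t\<bar> * norm (t - 0)"
    proof (rule differentiable_bound[of "{- \<bar>t\<bar>..\<bar>t\<bar>}"])
      fix s assume s: "s \<in> {- \<bar>t\<bar>..\<bar>t\<bar>}"
      then have sd: "\<bar>s\<bar> \<le> d" using t by auto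
      show "((\<lambda>s. E (z s)) has_derivative (\<lambda>h. E' (z s) (h *\<^sub>R A y))) (at s within {- \<bar>t\<bar>..\<bar>t\<bar>})"
        by (rule has_derivative_at_withinI, rule has_derivative_compose[of z])
          (auto simp: z_def[abs_def] intro!: derivative_eq_intros der z(3)[OF sd, unfolded z_def])
      interpret E: linear "E' (z s)" by (rule linear_E'[OF z(3)[OF sd]])
      show "onorm (\<lambda>h. E' (z s) (h *\<^sub>R A y)) \<le> C * a\<^sup>2 * \<bar>t\<bar>"
      proof (rule onorm_bound)
        show "0 \<le> C * a\<^sup>2 * \<bar>t\<bar>" using C(1) by simp
        fix h show "norm (E' (z s) (h *\<^sub>R A y)) \<le> C * a\<^sup>2 * \<bar>t\<bar> * norm h"
          using bound[of s] s by (auto simp: E.scale abs_mult mult.commute intro!: mult_mono)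
      qed
    qed auto
    then show ?thesis by (simp add: z_def power2_eq_square)
  qed
  show ?thesis
  proof (rule that[of "C * a\<^sup>2 / m" d])
    show "C * a\<^sup>2 / m > 0" "d > 0" using C(1) a(1) m(1) by (auto simp: d_def)
    show "norm (t *\<^sub>R A y) \<le> norm y / 2" if "\<bar>t\<bar> \<le> d" for t y by (rule small[OF that])
    fix t :: real and y :: 'a assume t: "\<bar>t\<bar> \<le> d"
    show "\<bar>E (y + t *\<^sub>R A y) - E y\<bar> \<le> C * a\<^sup>2 / m * t\<^sup>2 * E y"
    proof (cases "y = 0")
      case True
      then show ?thesis using A(1) by (simp add: zero linear_0)
    next
      case False
      \<comment> \<open>Both sides scale with \<open>(norm y)\<^sup>2\<close>, so the unit vector
        suffices; the factor \<open>1 / m\<close> then trades \<open>(norm y)\<^sup>2\<close> for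
        \<open>E y\<close>.\<close>
      define r u where "r = norm y" and "u = y /\<^sub>R norm y"
      have r: "r > 0" and u: "norm u = 1" and y: "y = r *\<^sub>R u" using False by (auto simp: r_def u_def)
      have "A y = r *\<^sub>R A u" using linear_cmul[OF A(1)] by (simp add: y)
      then have "y + t *\<^sub>R A y = r *\<^sub>R (u + t *\<^sub>R A u)" by (simp add: y scaleR_add_right)
      then have "E (y + t *\<^sub>R A y) - E y = r\<^sup>2 * (E (u + t *\<^sub>R A u) - E u)"
        using hom[OF r, of "u + t *\<^sub>R A u"] hom[OF r, of u] by (simp only: y right_diff_distrib)
      then have "\<bar>E (y + t *\<^sub>R A y) - E y\<bar> = (norm y)\<^sup>2 * \<bar>E (u + t *\<^sub>R A u) - E u\<bar>"
        by (simp add: abs_mult r_def)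
      also have "\<dots> \<le> (norm y)\<^sup>2 * (C * a\<^sup>2 * t\<^sup>2)"
        using unit[OF t u] by (intro mult_left_mono) auto
      also have "\<dots> = C * a\<^sup>2 / m * t\<^sup>2 * (m * (norm y)\<^sup>2)" using m(1) by simp
      also have "\<dots> \<le> C * a\<^sup>2 / m * t\<^sup>2 * E y"
        using m C(1) by (intro mult_left_mono) auto
      finally show ?thesis .
    qed
  qed
qed

definition unit_ball :: "'a set" where "unit_ball = {y. E y \<le> 1}"

lemma compact_unit_ball: "compact unit_ball"
proof -
  obtain m K where m: "m > 0" "\<And>y. m * (norm y)\<^sup>2 \<le> E y" using comparable by metis
  have "norm y \<le> 1 / sqrt m" if "E y \<le> 1" for y
  proof -
    have "(norm y)\<^sup>2 \<le> 1 / m" using m(2)[of y] that m(1) by (simp add: field_simps)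
    then show ?thesis using real_le_rsqrt real_sqrt_divide by fastforce
  qed
  then have "bounded unit_ball" by (auto simp: unit_ball_def bounded_iff)
  moreover have "closed unit_ball"
    unfolding unit_ball_def by (intro closed_Collect_le continuous_E continuous_intros)
  ultimately show ?thesis by (simp add: compact_eq_bounded_closed)
qed

text \<open>A box with nonempty interior inside the unit ball is what makes its volume and its
  second moments strictly positive.\<close>

lemma cbox_in_unit_ball: obtains d where "d > 0" "cbox (- d *\<^sub>R One) (d *\<^sub>R One) \<subseteq> unit_ball"
proof -
  have "isCont E 0" using continuous_E by (simp add: continuous_on_eq_continuous_at)
  then obtain e where e: "e > 0" "\<And>y. norm y < e \<Longrightarrow> E y \<le> 1"
    unfolding continuous_at_eps_delta by (force simp: zero dest: spec[of _ 1])
  \<comment> \<open>A point of the box has l1-norm at most \<open>DIM('a) * d = e/2\<close>.\<close>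
  define d where "d = e / (2 * DIM('a))"
  have "norm y < e" if "y \<in> cbox (- d *\<^sub>R One) (d *\<^sub>R One)" for y :: 'a
  proof -
    have "norm y \<le> (\<Sum>b\<in>Basis. \<bar>y \<bullet> b\<bar>)" by (rule norm_le_l1)
    also have "\<dots> \<le> (\<Sum>b\<in>(Basis::'a set). d)"
      by (intro sum_mono) (use that in \<open>auto simp: mem_box abs_le_iff dest: bspec\<close>)
    also have "\<dots> < e" using e(1) by (simp add: d_def)
    finally show ?thesis .
  qed
  then show ?thesis using e by (intro that[of d]) (auto simp: d_def unit_ball_def)
qed

end

section \<open>Integrals over compact sets and their images under linear maps\<close>

lemma continuous_on_compact_integrable:
  fixes f :: "'a::euclidean_space \<Rightarrow> real"
  assumes "compact S" "continuous_on S f"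
  shows "f absolutely_integrable_on S" "f integrable_on S"
proof -
  have "set_integrable lborel S f"
    unfolding set_integrable_def by (rule borel_integrable_compact[OF assms])
  then show "f absolutely_integrable_on S"
    unfolding set_integrable_def
    by (subst integrable_completion) (auto dest: borel_measurable_integrable)
  then show "f integrable_on S" by (rule set_lebesgue_integral_eq_integral)
qed

lemma integral_linear_image:
  fixes f :: "real^'n::{finite,wellorder} \<Rightarrow> real"
  assumes g: "linear g" and S: "compact S" and f: "continuous_on UNIV f"
  shows "integral (g ` S) f = \<bar>det (matrix g)\<bar> * integral S (\<lambda>x. f (g x))"
proof -
  \<comment> \<open>The change of variables rule is applied to vector-valued functions, so
    \<open>f\<close> is wrapped as a vector with one component.\<close>
  define F :: "real^'n::_ \<Rightarrow> real^1" where "F x = vec (f x)" for x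
  have cg: "compact (g ` S)" "continuous_on S g"
    using S g by (auto intro!: compact_continuous_image linear_continuous_on simp: linear_linear)
  have "f absolutely_integrable_on g ` S"
    by (intro continuous_on_compact_integrable cg continuous_on_subset[OF f]) auto
  then have F: "F absolutely_integrable_on g ` S"
    by (subst absolutely_integrable_componentwise_iff) (auto simp: F_def Basis_vec_def inner_axis)
  have fg: "(\<lambda>x. f (g x)) absolutely_integrable_on S"
    by (intro continuous_on_compact_integrable S continuous_on_compose2[OF f] cg) auto
  then have Fg: "(F \<circ> g) absolutely_integrable_on S"
    by (subst absolutely_integrable_componentwise_iff) (auto simp: F_def Basis_vec_def inner_axis)
  have "integral (g ` S) F = \<bar>det (matrix g)\<bar> *\<^sub>R integral S (F \<circ> g)"
    by (rule integral_change_of_variables_linear[OF g]) (use F in blast)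
  then have "integral (g ` S) F $ 1 = \<bar>det (matrix g)\<bar> * (integral S (F \<circ> g) $ 1)" by simp
  moreover have "integral (g ` S) F $ 1 = integral (g ` S) (\<lambda>x. F x $ 1)"
    by (rule integral_component_eq_cart[symmetric], rule set_lebesgue_integral_eq_integral[OF F])
  moreover have "integral S (F \<circ> g) $ 1 = integral S (\<lambda>x. (F \<circ> g) x $ 1)"
    by (rule integral_component_eq_cart[symmetric], rule set_lebesgue_integral_eq_integral[OF Fg])
  ultimately show ?thesis by (simp add: F_def)
qed

lemma integral_scaled_set:
  fixes f :: "real^'n::{finite,wellorder} \<Rightarrow> real"
  assumes r: "r > 0" and S: "compact S" and f: "continuous_on UNIV f"
  shows "integral ((\<lambda>x. r *\<^sub>R x) ` S) f = r ^ CARD('n) * integral S (\<lambda>x. f (r *\<^sub>R x))"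
proof -
  have "det (matrix ((*\<^sub>R) r :: real^'n::_ \<Rightarrow> real^'n::_)) = r ^ CARD('n)"
    by (simp add: matrix_scaleR det_diagonal mat_def)
  then show ?thesis
    using integral_linear_image[of "(*\<^sub>R) r" S f] assms by simp
qed

lemma integral_mono_compact:
  fixes f :: "'a::euclidean_space \<Rightarrow> real"
  assumes "S \<subseteq> T" "compact S" "compact T" "continuous_on UNIV f" "\<And>x. f x \<ge> 0"
  shows "integral S f \<le> integral T f"
  using assms by (intro integral_subset_le continuous_on_compact_integrable continuous_on_subset[OF assms(4)]) auto

section \<open>Second moments of the unit ball\<close>

context squared_norm
begin

text \<open>Here \<open>u\<close> and \<open>v\<close> stand for the linear forms given by the inner
  products with them, so this is an inner product on the dual space. Linear fields act on it through
  their adjoints.\<close>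

definition moment :: "'a \<Rightarrow> 'a \<Rightarrow> real" where
  "moment u v = integral unit_ball (\<lambda>y. (u \<bullet> y) * (v \<bullet> y))"

lemma moment_integrable: "(\<lambda>y. (u \<bullet> y) * (v \<bullet> y)) integrable_on unit_ball"
  by (intro continuous_on_compact_integrable compact_unit_ball continuous_intros)

lemma moment_sym: "moment u v = moment v u"
  by (simp add: moment_def mult.commute)

lemma moment_add: "moment (u + u') v = moment u v + moment u' v"
  unfolding moment_def inner_add_left distrib_right
  by (rule integral_add[OF moment_integrable moment_integrable])

lemma moment_scale: "moment (r *\<^sub>R u) v = r * moment u v"
  by (simp add: moment_def mult.assoc)

lemma moment_linear: "linear (\<lambda>u. moment u v)" "linear (moment v)"
  by (rule linearI; simp add: moment_add moment_scale moment_sym[of v])+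

lemma moment_pos:
  assumes "u \<noteq> 0" shows "moment u u > 0"
proof -
  obtain d where d: "d > 0" "cbox (- d *\<^sub>R One) (d *\<^sub>R One) \<subseteq> unit_ball" (is "?Q \<subseteq> _")
    using cbox_in_unit_ball by blast
  let ?f = "\<lambda>y. (u \<bullet> y) * (u \<bullet> y)"
  have cont: "continuous_on S ?f" for S by (intro continuous_intros)
  have "integral ?Q ?f \<le> moment u u"
    unfolding moment_def by (intro integral_mono_compact d(2) compact_unit_ball cont) auto
  moreover have "integral ?Q ?f \<ge> 0"
    by (intro integral_nonneg continuous_on_compact_integrable cont) auto
  moreover have "integral ?Q ?f \<noteq> 0"
  proof
    assume 0: "integral ?Q ?f = 0"
    \<comment> \<open>The point \<open>e u\<close> has norm at most \<open>d\<close>, hence lies in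
      the box, and the integrand is positive at it. A vanishing integral of a continuous nonnegative
      function would make it zero on the whole box.\<close>
    define e where "e = d / (norm u + 1)"
    have "e > 0" using d(1) by (simp add: e_def add_nonneg_pos)
    have "norm (e *\<^sub>R u) = d * (norm u / (norm u + 1))"
      using d(1) by (simp add: e_def)
    also have "\<dots> \<le> d * 1"
      using d(1) by (intro mult_left_mono) (auto simp: divide_le_eq_1 add_nonneg_pos)
    finally have "norm (e *\<^sub>R u) \<le> d" by simp
    from 0 have "(?f has_integral 0) ?Q"
      using continuous_on_compact_integrable(2)[OF compact_cbox cont] has_integral_integral by metis
    moreover have "box (- d *\<^sub>R One) (d *\<^sub>R One :: 'a) \<noteq> {}"
      using d(1) by (auto simp: box_ne_empty)
    moreover have "e *\<^sub>R u \<in> ?Q"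
      using \<open>norm (e *\<^sub>R u) \<le> d\<close> Basis_le_norm[of _ "e *\<^sub>R u"] by (force simp: mem_box abs_le_iff)
    ultimately have "?f (e *\<^sub>R u) = 0"
      by (intro has_integral_0_cbox_imp_0[of "- d *\<^sub>R One" "d *\<^sub>R One" ?f] cont) auto
    then show False using \<open>e > 0\<close> assms by simp
  qed
  ultimately show ?thesis by linarith
qed

end

text \<open>Let \<open>T = 1 + t A\<close>. By \<open>almost_invariant\<close>, the image of the
  unit ball under \<open>T\<close> lies between two balls scaled by \<open>1 - c t^2\<close> and
  \<open>1 + c t^2\<close>. Integrating the square of the form \<open>u\<close> over the image gives
  \<open>P t\<close> times the determinant, so both are known up to second order, and the derivative
  of \<open>P\<close> at 0, which is twice the claimed quantity, must vanish.\<close>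

lemma moment_invariant:
  fixes E :: "real^'n::{finite,wellorder} \<Rightarrow> real"
  assumes "squared_norm E E'" and A: "linear A" "\<And>z. z \<noteq> 0 \<Longrightarrow> E' z (A z) = 0"
  shows "squared_norm.moment E u (adjoint A u) = 0"
proof -
  interpret squared_norm E E' by fact
  obtain c d where cd: "c > 0" "d > 0"
    "\<And>t y. \<bar>t\<bar> \<le> d \<Longrightarrow> \<bar>E (y + t *\<^sub>R A y) - E y\<bar> \<le> c * t\<^sup>2 * E y"
    "\<And>t y. \<bar>t\<bar> \<le> d \<Longrightarrow> norm (t *\<^sub>R A y) \<le> norm y / 2"
    using almost_invariant[OF A] by blast
  define n where "n = CARD('n)"
  define P where "P t = moment (u + t *\<^sub>R adjoint A u) (u + t *\<^sub>R adjoint A u)" for t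
  define v where "v = integral unit_ball (\<lambda>y. 1::real)"
  have v: "v > 0"
  proof -
    obtain e where e: "e > 0" "cbox (- e *\<^sub>R One) (e *\<^sub>R One) \<subseteq> unit_ball" (is "?Q \<subseteq> _")
      using cbox_in_unit_ball by blast
    have "box (- e *\<^sub>R One) (e *\<^sub>R One :: real^'n::_) \<noteq> {}" using e(1) by (auto simp: box_ne_empty)
    then have "measure lborel ?Q > 0"
      by (simp add: content_pos_lt_eq box_ne_empty)
    moreover have "integral ?Q (\<lambda>y. 1::real) \<le> v"
      unfolding v_def by (intro integral_mono_compact e(2) compact_unit_ball) auto
    moreover have "integral ?Q (\<lambda>y. 1::real) = measure lborel ?Q"
      by (simp only: integral_const) simp
    ultimately show ?thesis by linarith
  qed
  have main: "(1 - c * t\<^sup>2) ^ n * P t \<le> (1 + c * t\<^sup>2) ^ (n + 2) * P 0"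
    if t: "\<bar>t\<bar> \<le> d" and ct: "c * t\<^sup>2 < 1" for t
  proof -
    define T where "T y = y + t *\<^sub>R A y" for y
    \<comment> \<open>\<open>E\<close> changes under \<open>T\<close> by a factor between
      \<open>r'\<close> and \<open>r\<close>. Square roots of these would serve as radii;
      \<open>r\<close> and \<open>r'\<close> themselves do so without roots, since
      \<open>r \<le> r^2\<close> and \<open>r'^2 \<le> r'\<close>, and they still differ from 1 only
      by a term in \<open>t^2\<close>.\<close>
    define r where "r = 1 + c * t\<^sup>2"
    define r' where "r' = 1 - c * t\<^sup>2"
    have r: "r \<ge> 1" "r > 0" "r' > 0" "r' \<le> 1" using cd(1) ct by (auto simp: r_def r'_def add_pos_nonneg)
    have T: "linear T" unfolding T_def
      using A(1) by (intro linearI) (auto simp: linear_add linear_cmul algebra_simps)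
    have "inj T"
    proof (rule linear_injective_0[THEN iffD2, OF T, rule_format], rule ccontr)
      fix y assume "T y = 0" "y \<noteq> 0"
      then have "norm y = norm (t *\<^sub>R A y)"
        by (metis T_def add_eq_0_iff norm_minus_cancel)
      then have "norm y \<le> norm y / 2" using cd(4)[OF t, of y] by linarith
      then show False using \<open>y \<noteq> 0\<close> by simp
    qed
    then have "surj T" using T linear_injective_imp_surjective by blast
    have ET: "E (T y) \<le> r * E y" "r' * E y \<le> E (T y)" for y
      using cd(3)[OF t, of y] by (auto simp: T_def r_def r'_def algebra_simps abs_le_iff)
    have sub1: "T ` unit_ball \<subseteq> (\<lambda>y. r *\<^sub>R y) ` unit_ball"
    proof
      fix z assume "z \<in> T ` unit_ball"
      then obtain y where y: "E y \<le> 1" "z = T y" by (auto simp: unit_ball_def)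
      have "E z \<le> r * 1" using ET(1)[of y] y(2) mult_left_mono[OF y(1) less_imp_le[OF r(2)]] by simp
      also have "\<dots> \<le> r\<^sup>2" using r(1) by (simp add: power2_eq_square)
      finally have "(inverse r)\<^sup>2 * E z \<le> (inverse r)\<^sup>2 * r\<^sup>2" by (intro mult_left_mono) auto
      also have "\<dots> = 1" using r(2) by (simp flip: power_mult_distrib)
      finally have "E (inverse r *\<^sub>R z) \<le> 1" using hom[of "inverse r" z] r(2) by simp
      then show "z \<in> (\<lambda>y. r *\<^sub>R y) ` unit_ball"
        using r(2) by (intro image_eqI[of _ _ "inverse r *\<^sub>R z"]) (auto simp: unit_ball_def)
    qed
    have sub2: "(\<lambda>y. r' *\<^sub>R y) ` unit_ball \<subseteq> T ` unit_ball"
    proof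
      fix z assume "z \<in> (\<lambda>y. r' *\<^sub>R y) ` unit_ball"
      then obtain y where y: "E y \<le> 1" "z = r' *\<^sub>R y" by (auto simp: unit_ball_def)
      obtain x where x: "z = T x" using \<open>surj T\<close> by (metis surjD)
      have "r' * E x \<le> r'\<^sup>2 * E y" using ET(2)[of x] x y(2) hom[OF r(3), of y] by simp
      also have "\<dots> \<le> r' * r' * 1" unfolding power2_eq_square using y(1) r(3) by (intro mult_left_mono) auto
      also have "\<dots> \<le> r' * 1" using r(3,4) by simp
      finally have "E x \<le> 1" using r(3) by simp
      then show "z \<in> T ` unit_ball" using x by (auto simp: unit_ball_def)
    qed
    \<comment> \<open>The determinant is never computed: the inclusion \<open>sub2\<close> of sets
      of known volume bounds it below by \<open>r' ^ n\<close>.\<close>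
    define J where "J = \<bar>det (matrix T)\<bar>"
    define f where "f = (\<lambda>y. (u \<bullet> y) * (u \<bullet> y))"
    have f: "continuous_on UNIV f" "\<And>y. f y \<ge> 0" unfolding f_def by (intro continuous_intros) auto
    have comp: "compact (T ` unit_ball)" "compact ((\<lambda>y. s *\<^sub>R y) ` unit_ball)" for s :: real
      by (intro compact_continuous_image compact_unit_ball linear_continuous_on bounded_linear_scaleR_right
          T[unfolded linear_conv_bounded_linear])+
    have "r' ^ n * v = integral ((\<lambda>y. r' *\<^sub>R y) ` unit_ball) (\<lambda>y. 1)"
      using integral_scaled_set[OF r(3) compact_unit_ball, of "\<lambda>y. 1"] by (simp add: v_def n_def)
    also have "\<dots> \<le> integral (T ` unit_ball) (\<lambda>y. 1)"
      by (intro integral_mono_compact sub2 comp) auto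
    also have "\<dots> = J * v"
      using integral_linear_image[OF T compact_unit_ball, of "\<lambda>y. 1"] by (simp add: v_def J_def)
    finally have J: "r' ^ n \<le> J" using v by simp
    have "f (T y) = ((u + t *\<^sub>R adjoint A u) \<bullet> y) * ((u + t *\<^sub>R adjoint A u) \<bullet> y)" for y
    proof -
      have "(u + t *\<^sub>R adjoint A u) \<bullet> y = u \<bullet> T y"
        using adjoint_works[OF A(1), of y u] by (simp add: T_def inner_add_left inner_add_right inner_commute)
      then show ?thesis by (simp add: f_def)
    qed
    then have PT: "P t = integral unit_ball (\<lambda>y. f (T y))" by (simp add: P_def moment_def)
    have P0: "P 0 = integral unit_ball f" by (simp add: P_def moment_def f_def)
    have "P t \<ge> 0" unfolding P_def moment_def
      by (intro integral_nonneg moment_integrable) auto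
    then have "r' ^ n * P t \<le> J * P t" using J by (rule mult_right_mono[rotated])
    also have "\<dots> = integral (T ` unit_ball) f"
      using integral_linear_image[OF T compact_unit_ball f(1)] by (simp add: PT J_def)
    also have "\<dots> \<le> integral ((\<lambda>y. r *\<^sub>R y) ` unit_ball) f"
      by (intro integral_mono_compact sub1 comp f)
    also have "\<dots> = r ^ n * integral unit_ball (\<lambda>y. r\<^sup>2 * f y)"
      using integral_scaled_set[OF r(2) compact_unit_ball f(1)] by (simp add: n_def f_def power2_eq_square mult_ac)
    \<comment> \<open>The exponent \<open>n\<close> comes from the volume, the additional 2 from the
      quadratic integrand.\<close>
    also have "\<dots> = r ^ (n + 2) * P 0" by (simp add: P0 power_add power2_eq_square)
    finally show ?thesis by (simp add: r_def r'_def)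
  qed
  \<comment> \<open>The slack in \<open>main\<close>. It is 0 at \<open>t = 0\<close> and
    nonnegative nearby, hence has a local minimum there; its terms in \<open>t^2\<close> do not
    contribute to the derivative at 0.\<close>
  define h where "h t = (1 + c * t\<^sup>2) ^ (n + 2) * P 0 - (1 - c * t\<^sup>2) ^ n * P t" for t
  have Pt: "P t = moment u u + 2 * t * moment u (adjoint A u) + t\<^sup>2 * moment (adjoint A u) (adjoint A u)" for t
    using moment_linear(1) moment_linear(2)
    by (simp add: P_def linear_add linear_cmul moment_add moment_scale moment_sym[of "adjoint A u" u]
        power2_eq_square algebra_simps)
  have h': "(h has_real_derivative - 2 * moment u (adjoint A u)) (at 0)"
    unfolding h_def Pt by (auto intro!: derivative_eq_intros)
  \<comment> \<open>The bound \<open>1 / (c + 1)\<close> gives both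
    \<open>\<bar>t\<bar> \<le> 1\<close> and \<open>c * \<bar>t\<bar> < 1\<close>, hence the
    condition \<open>c * t\<^sup>2 < 1\<close> of \<open>main\<close>.\<close>
  have h_min: "h 0 \<le> h t" if "\<bar>0 - t\<bar> < min d (1 / (c + 1))" for t
  proof -
    have "\<bar>t\<bar> * (c + 1) < 1" using that cd(1) by (simp add: pos_less_divide_eq)
    moreover have "\<bar>t\<bar> \<le> 1" using calculation cd(1) by (smt (verit) mult_le_cancel_left1)
    then have "c * \<bar>t\<bar> * \<bar>t\<bar> \<le> c * \<bar>t\<bar> * 1" using cd(1) by (intro mult_left_mono) auto
    ultimately have "c * t\<^sup>2 < 1" by (simp add: power2_eq_square algebra_simps abs_mult_self_eq) 
    moreover have "\<bar>t\<bar> \<le> d" using that by simp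
    ultimately show ?thesis using main[of t] by (simp add: h_def)
  qed
  have "- 2 * moment u (adjoint A u) = 0"
    by (rule DERIV_local_min[OF h', of "min d (1 / (c + 1))"]) (use cd h_min in auto)
  then show ?thesis by simp
qed

text \<open>The Gram map \<open>W\<close> of the moments goes from linear forms to vectors, and its
  inverse \<open>V\<close> carries the moment form back to an inner product \<open>q\<close> on
  vectors. The quotient of \<open>q\<close> and \<open>E\<close> has derivative zero along each
  \<open>A y\<close>, because both are invariant, and along \<open>y\<close>, because both have
  degree 2. By assumption these directions exhaust the space.\<close>

lemma quadratic_if_transitive_wellorder:
  fixes E :: "real^'n::{finite,wellorder} \<Rightarrow> real"
  assumes "squared_norm E E'" and n: "CARD('n) \<ge> 2"
    and transitive: "\<And>y w. y \<noteq> 0 \<Longrightarrow>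
      \<exists>A c. linear A \<and> (\<forall>z. z \<noteq> 0 \<longrightarrow> E' z (A z) = 0) \<and> w = A y + c *\<^sub>R y"
  shows "\<exists>q. bilinear q \<and> (\<forall>y. E y = q y y)"
proof -
  interpret squared_norm E E' by fact
  define W where "W u = (\<Sum>b\<in>Basis. moment u b *\<^sub>R b)" for u
  have W: "linear W"
    unfolding W_def
    by (rule linearI) (simp_all add: moment_add moment_scale scaleR_add_left sum.distrib scaleR_sum_right)
  have W_inner: "W u \<bullet> v = moment u v" for u v
  proof -
    have "moment u v = moment u (\<Sum>b\<in>Basis. (v \<bullet> b) *\<^sub>R b)" by (simp add: euclidean_representation)
    also have "\<dots> = (\<Sum>b\<in>Basis. (v \<bullet> b) * moment u b)"
      by (simp add: linear_sum[OF moment_linear(2)] linear_cmul[OF moment_linear(2)])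
    finally show ?thesis by (simp add: W_def inner_sum_left inner_commute[of v] mult.commute)
  qed
  have "inj W"
  proof (rule linear_injective_0[THEN iffD2, OF W, rule_format], rule ccontr)
    fix u assume "W u = 0" "u \<noteq> 0"
    then show False using W_inner[of u u] moment_pos[of u] by simp
  qed
  then obtain V where V: "linear V" "\<And>x. V (W x) = x" "\<And>x. W (V x) = x"
    using linear_injective_isomorphism[OF W] by blast
  define q where "q y z = V y \<bullet> z" for y z
  have q: "bilinear q"
    unfolding q_def bilinear_def using V(1)
    by (auto intro!: linearI simp: inner_add_left inner_add_right linear_add linear_cmul)
  have q_moment: "q y z = moment (V y) (V z)" for y z
    using W_inner[of "V z" "V y"] by (simp add: q_def V(3) inner_commute moment_sym)
  have q_sym: "q y z = q z y" for y z by (simp add: q_moment moment_sym)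
  \<comment> \<open>Moving \<open>A\<close> across the inner product turns \<open>q y (A y)\<close>
    into the moment of \<open>V y\<close> with \<open>adjoint A (V y)\<close>.\<close>
  have q_invariant: "q y (A y) = 0" if "linear A" "\<forall>z. z \<noteq> 0 \<longrightarrow> E' z (A z) = 0" for A y
  proof -
    have "0 = W (V y) \<bullet> adjoint A (V y)"
      using moment_invariant[OF assms(1) that(1), of "V y"] that(2) by (simp add: W_inner)
    then show ?thesis
      using adjoint_works[OF that(1), of y "V y"] by (simp add: V(3) q_def inner_commute)
  qed
  interpret q: bounded_bilinear q using q by (simp add: bilinear_conv_bounded_bilinear)
  have zero_derivative: "((\<lambda>y. q y y / E y) has_derivative (\<lambda>h. 0)) (at y)" if y: "y \<in> - {0}" for y
  proof -
    have "y \<noteq> 0" using y by simp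
    interpret E': linear "E' y" by (rule linear_E'[OF \<open>y \<noteq> 0\<close>])
    \<comment> \<open>The numerator of the quotient rule: for \<open>w = A y + c y\<close> only the
      radial part survives, giving \<open>c\<close> times \<open>q y y\<close> and \<open>c\<close>
      times \<open>2 E y\<close> respectively.\<close>
    have "2 * q y w * E y = q y y * E' y w" for w
    proof -
      obtain A c where A: "linear A" "\<forall>z. z \<noteq> 0 \<longrightarrow> E' z (A z) = 0" "w = A y + c *\<^sub>R y"
        using transitive[OF \<open>y \<noteq> 0\<close>] by blast
      then have "q y w = c * q y y" "E' y w = c * (2 * E y)"
        using euler[OF \<open>y \<noteq> 0\<close>] \<open>y \<noteq> 0\<close> q_invariant[OF A(1,2)]
        by (simp_all add: q.add_right q.scaleR_right E'.add E'.scale)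
      then show ?thesis by simp
    qed
    then have *: "(q y w + q w y) * E y = q y y * E' y w" for w
      by (simp add: q_sym[of w y])
    have "((\<lambda>y. q y y / E y) has_derivative (\<lambda>h. ((q y h + q h y) * E y - q y y * E' y h) / (E y * E y))) (at y)"
      by (rule has_derivative_divide' q.FDERIV has_derivative_ident der \<open>y \<noteq> 0\<close>)+
        (use pos[OF \<open>y \<noteq> 0\<close>] in simp)
    also have "(\<lambda>h. ((q y h + q h y) * E y - q y y * E' y h) / (E y * E y)) = (\<lambda>h. 0)"
      by (simp add: *)
    finally show ?thesis .
  qed
  \<comment> \<open>Dimension at least 2 enters here. On a line the two half-lines could carry
    different factors, since \<open>E\<close> may be asymmetric.\<close>
  have conn: "connected (- {0 :: real^'n::_})"
    by (rule connected_punctured_universe) (use n in simp)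
  define p :: "real^'n::_" where "p = axis (SOME i. True) 1"
  have p: "p \<noteq> 0" by (simp add: p_def axis_eq_0_iff)
  define k where "k = q p p / E p"
  have k: "q y y / E y = k" if "y \<noteq> 0" for y
    unfolding k_def using that p
    by (intro has_derivative_zero_unique_connected[OF _ conn zero_derivative]) auto
  have "V p \<noteq> 0" using V(3)[of p] linear_0[OF W] p by auto
  then have "k > 0" using moment_pos[of "V p"] pos[OF p] by (simp add: k_def q_moment)
  have "E y = q y y / k" for y
  proof (cases "y = 0")
    case False
    then show ?thesis using k[OF False] \<open>k > 0\<close> pos[OF False] by (auto simp: field_simps)
  qed (simp add: zero q.zero_left)
  moreover have "bilinear (\<lambda>y z. q y z / k)"
    unfolding bilinear_def
    by (auto intro!: linearI simp: q.add_left q.add_right q.scaleR_left q.scaleR_right add_divide_distrib)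
  ultimately show ?thesis by blast
qed

text \<open>The change of variables theorems of the library need a well-ordered index type, so an arbitrary
  finite index type is replaced by a copy of it that carries an arbitrary linear order.\<close>

typedef 'n ordered_copy = "UNIV :: 'n set" by simp

lemma UNIV_ordered_copy: "(UNIV :: 'n ordered_copy set) = range Abs_ordered_copy"
  by (rule sym, rule surjI, rule Rep_ordered_copy_inverse)

instance ordered_copy :: (finite) finite
  by standard (simp add: UNIV_ordered_copy)

definition index_number :: "'n::finite ordered_copy \<Rightarrow> nat" where
  "index_number = (SOME f. inj f)"

lemma inj_index_number: "inj index_number"
  unfolding index_number_def
  by (rule someI_ex[of inj]) (meson finite_imp_inj_to_nat_seg finite_class.finite_UNIV)

instantiation ordered_copy :: (finite) wellorder
begin

definition less_eq_ordered_copy :: "'a ordered_copy \<Rightarrow> 'a ordered_copy \<Rightarrow> bool" where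
  "x \<le> y \<longleftrightarrow> index_number x \<le> index_number y"

definition less_ordered_copy :: "'a ordered_copy \<Rightarrow> 'a ordered_copy \<Rightarrow> bool" where
  "x < y \<longleftrightarrow> index_number x < index_number y"

instance
proof
  fix P :: "'a ordered_copy \<Rightarrow> bool" and a
  assume step: "\<And>x. (\<And>y. y < x \<Longrightarrow> P y) \<Longrightarrow> P x"
  show "P a"
  proof (induction a rule: measure_induct_rule[where f = index_number])
    case (less x)
    show ?case by (rule step, rule less.IH) (simp add: less_ordered_copy_def)
  qed
qed (auto simp: less_eq_ordered_copy_def less_ordered_copy_def dest: injD[OF inj_index_number])

end

lemma bij_Rep_ordered_copy: "bij Rep_ordered_copy"
proof (rule bijI)
  show "inj Rep_ordered_copy" by (simp add: inj_def Rep_ordered_copy_inject)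
  show "surj Rep_ordered_copy" by (rule surjI[of _ Abs_ordered_copy]) (simp add: Abs_ordered_copy_inverse)
qed

theorem quadratic_if_transitive:
  fixes E :: "real^'n::finite \<Rightarrow> real"
  assumes "squared_norm E E'" and n: "CARD('n) \<ge> 2"
    and transitive: "\<And>y w. y \<noteq> 0 \<Longrightarrow>
      \<exists>A c. linear A \<and> (\<forall>z. z \<noteq> 0 \<longrightarrow> E' z (A z) = 0) \<and> w = A y + c *\<^sub>R y"
  shows "\<exists>q. bilinear q \<and> (\<forall>y. E y = q y y)"
proof -
  interpret squared_norm E E' by fact
  \<comment> \<open>\<open>f\<close> and \<open>g\<close> only relabel coordinates; \<open>E\<close>
    is pulled back along \<open>f\<close> and each field \<open>A\<close> is conjugated to
    \<open>g (A (f x))\<close>.\<close>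
  define f :: "real^'n ordered_copy \<Rightarrow> real^'n" where "f x = (\<chi> i. x $ Abs_ordered_copy i)" for x
  define g :: "real^'n \<Rightarrow> real^'n ordered_copy" where "g x = (\<chi> i. x $ Rep_ordered_copy i)" for x
  have f: "linear f" by (rule linearI) (simp_all add: f_def vec_eq_iff)
  have g: "linear g" by (rule linearI) (simp_all add: g_def vec_eq_iff)
  have fg: "f (g x) = x" and gf: "g (f z) = z" for x z
    by (simp_all add: f_def g_def vec_eq_iff Abs_ordered_copy_inverse Rep_ordered_copy_inverse)
  have f0: "f z = 0 \<longleftrightarrow> z = 0" for z using gf linear_0[OF f] linear_0[OF g] by metis
  have "squared_norm (\<lambda>z. E (f z)) (\<lambda>z v. E' (f z) (f v))"
  proof
    fix r :: real and z v
    show "E (f (r *\<^sub>R z)) = r\<^sup>2 * E (f z)" if "r > 0" by (simp add: linear_cmul[OF f] hom[OF that])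
    show "E (f z) > 0" if "z \<noteq> 0" using that pos f0 by blast
    show "E (f 0) = 0" using linear_0[OF f] zero by simp
    show "((\<lambda>z. E (f z)) has_derivative (\<lambda>v. E' (f z) (f v))) (at z)" if "z \<noteq> 0"
      by (rule has_derivative_compose[of f f]) (use f0 that in \<open>auto intro!: der linear_imp_has_derivative f\<close>)
    show "continuous_on (- {0}) (\<lambda>z. E' (f z) (f v))"
    proof (rule continuous_on_compose2[of "- {0}" "\<lambda>y. E' y (f v)" "- {0}" f])
      show "continuous_on (- {0}) (\<lambda>y. E' y (f v))" by (rule der_cont)
      show "continuous_on (- {0}) f"
        using f by (simp add: linear_continuous_on linear_conv_bounded_linear)
      show "f ` (- {0}) \<subseteq> - {0}" by (intro image_subsetI) (simp add: f0)
    qed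
  qed
  moreover have "CARD('n ordered_copy) \<ge> 2"
    using n bij_betw_same_card[OF bij_Rep_ordered_copy] by metis
  moreover have "\<exists>A c. linear A \<and> (\<forall>z. z \<noteq> 0 \<longrightarrow> E' (f z) (f (A z)) = 0) \<and> w = A y + c *\<^sub>R y"
    if "y \<noteq> 0" for y w
  proof -
    have "f y \<noteq> 0" using that f0 by blast
    then obtain A c where A: "linear A" "\<forall>z. z \<noteq> 0 \<longrightarrow> E' z (A z) = 0" "f w = A (f y) + c *\<^sub>R f y"
      using transitive by blast
    have "linear (\<lambda>x. g (A (f x)))"
      using linear_compose[OF linear_compose[OF f A(1)] g] by (simp add: o_def)
    moreover have "g (f w) = g (A (f y)) + c *\<^sub>R g (f y)"
      by (simp only: A(3) linear_add[OF g] linear_cmul[OF g])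
    then have "w = g (A (f y)) + c *\<^sub>R y" by (simp add: gf)
    ultimately show ?thesis
      using A(2) f0 by (intro exI[of _ "\<lambda>x. g (A (f x))"] exI[of _ c]) (auto simp: fg)
  qed
  ultimately obtain q where q: "bilinear q" "\<And>z. E (f z) = q z z"
    using quadratic_if_transitive_wellorder[of "\<lambda>z. E (f z)" "\<lambda>z v. E' (f z) (f v)"] by metis
  have "bilinear (\<lambda>y z. q (g y) (g z))"
    unfolding bilinear_def[of "\<lambda>y z. q (g y) (g z)"]
    by (auto intro!: linearI simp: linear_add[OF g] linear_cmul[OF g] bilinear_ladd[OF q(1)]
        bilinear_radd[OF q(1)] bilinear_lmul[OF q(1)] bilinear_rmul[OF q(1)])
  moreover have "E y = q (g y) (g y)" for y using q(2)[of "g y"] by (simp add: fg)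
  ultimately show ?thesis by blast
qed

section \<open>Partial derivatives on the tangent bundle\<close>

text \<open>The two functions have exactly the same derivatives at \<open>x\<close>, so the choice
  inside \<open>frechet_derivative\<close> agrees even where there is none. The congruence rules for
  \<open>dx\<close>, \<open>dy\<close> and \<open>hderiv\<close> therefore come without
  differentiability conditions.\<close>

lemma frechet_derivative_cong_open:
  assumes "open S" "x \<in> S" "\<And>z. z \<in> S \<Longrightarrow> f z = g z"
  shows "frechet_derivative f (at x) = frechet_derivative g (at x)"
proof -
  have "(f has_derivative D) (at x) \<longleftrightarrow> (g has_derivative D) (at x)" for D
    using assms has_derivative_transform_within_open[of f D x UNIV S g]
      has_derivative_transform_within_open[of g D x UNIV S f] by auto
  then show ?thesis by (simp add: frechet_derivative_def)
qed

lemma differentiable_cong_open: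
  assumes "f differentiable at x" "open S" "x \<in> S" "\<And>z. z \<in> S \<Longrightarrow> f z = g z"
  shows "g differentiable at x"
  using assms has_derivative_transform_within_open[of f _ x UNIV S g] unfolding differentiable_def by blast

abbreviation xdiff :: "(real^'n \<Rightarrow> real^'n \<Rightarrow> real) \<Rightarrow> real^'n \<Rightarrow> real^'n::finite \<Rightarrow> bool" where
  "xdiff f x y \<equiv> (\<lambda>x'. f x' y) differentiable at x"

abbreviation ydiff :: "(real^'n \<Rightarrow> real^'n \<Rightarrow> real) \<Rightarrow> real^'n \<Rightarrow> real^'n::finite \<Rightarrow> bool" where
  "ydiff f x y \<equiv> (\<lambda>y'. f x y') differentiable at y"

lemma dx_eqI: "((\<lambda>x'. f x' y) has_derivative D) (at x) \<Longrightarrow> dx k f x y = D (axis k 1)"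
  by (simp add: dx_def frechet_derivative_at[symmetric])

lemma dy_eqI: "((\<lambda>y'. f x y') has_derivative D) (at y) \<Longrightarrow> dy k f x y = D (axis k 1)"
  by (simp add: dy_def frechet_derivative_at[symmetric])

lemma dx_cong:
  assumes "open U" "x \<in> U" "\<And>x'. x' \<in> U \<Longrightarrow> f x' y = g x' y"
  shows "dx k f x y = dx k g x y"
  using frechet_derivative_cong_open[OF assms] by (simp add: dx_def)

lemma dy_cong:
  assumes "y \<noteq> 0" "\<And>y'. y' \<noteq> 0 \<Longrightarrow> f x y' = g x y'"
  shows "dy k f x y = dy k g x y"
  using frechet_derivative_cong_open[of "- {0}" y "f x" "g x"] assms by (simp add: dy_def open_Compl[OF closed_singleton])

lemma dx_scale: "xdiff f x y \<Longrightarrow> dx k (\<lambda>x y. c * f x y) x y = c * dx k f x y"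
  unfolding dx_def[of k f]
  by (rule dx_eqI[where f = "\<lambda>x y. c * f x y"], rule has_derivative_mult_right) (simp only: frechet_derivative_works)

lemma dy_scale: "ydiff f x y \<Longrightarrow> dy k (\<lambda>x y. c * f x y) x y = c * dy k f x y"
  unfolding dy_def[of k f]
  by (rule dy_eqI[where f = "\<lambda>x y. c * f x y"], rule has_derivative_mult_right) (simp only: frechet_derivative_works)

lemma dx_sum_mult:
  assumes "\<And>r. xdiff (f r) x y" "\<And>r. xdiff (g r) x y"
  shows "dx k (\<lambda>x y. \<Sum>r\<in>A. f r x y * g r x y) x y
    = (\<Sum>r\<in>A. dx k (f r) x y * g r x y) + (\<Sum>r\<in>A. f r x y * dx k (g r) x y)"
proof -
  have "((\<lambda>x'. \<Sum>r\<in>A. f r x' y * g r x' y) has_derivative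
    (\<lambda>h. \<Sum>r\<in>A. f r x y * frechet_derivative (\<lambda>x'. g r x' y) (at x) h
        + frechet_derivative (\<lambda>x'. f r x' y) (at x) h * g r x y)) (at x)"
    by (intro has_derivative_sum has_derivative_mult assms[unfolded frechet_derivative_works])
  from dx_eqI[where f = "\<lambda>x y. \<Sum>r\<in>A. f r x y * g r x y", OF this, of k] show ?thesis by (simp add: dx_def sum.distrib)
qed

lemma dy_sum_mult:
  assumes "\<And>r. ydiff (f r) x y" "\<And>r. ydiff (g r) x y"
  shows "dy k (\<lambda>x y. \<Sum>r\<in>A. f r x y * g r x y) x y
    = (\<Sum>r\<in>A. dy k (f r) x y * g r x y) + (\<Sum>r\<in>A. f r x y * dy k (g r) x y)"
proof -
  have "((\<lambda>y'. \<Sum>r\<in>A. f r x y' * g r x y') has_derivative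
    (\<lambda>h. \<Sum>r\<in>A. f r x y * frechet_derivative (\<lambda>y'. g r x y') (at y) h
        + frechet_derivative (\<lambda>y'. f r x y') (at y) h * g r x y)) (at y)"
    by (intro has_derivative_sum has_derivative_mult assms[unfolded frechet_derivative_works])
  from dy_eqI[where f = "\<lambda>x y. \<Sum>r\<in>A. f r x y * g r x y", OF this, of k] show ?thesis by (simp add: dy_def sum.distrib)
qed

lemma dx_component: "dx k (\<lambda>x y. y $ r) x y = 0"
  by (simp add: dx_def)

lemma dy_component: "dy k (\<lambda>x y. y $ r) x y = (if k = r then 1 else 0)"
  by (subst dy_eqI[of "\<lambda>x y. y $ r" _ "\<lambda>h. h $ r"])
    (auto simp: axis_def intro!: bounded_linear_imp_has_derivative)

lemma ydiff_component: "ydiff (\<lambda>x y. y $ r) x y"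
  by (rule bounded_linear_imp_differentiable) (rule bounded_linear_vec_nth)

lemma dx_contract:
  assumes "\<And>r. xdiff (f r) x y"
  shows "dx k (\<lambda>x y. \<Sum>r\<in>UNIV. y $ r * f r x y) x y = (\<Sum>r\<in>UNIV. y $ r * dx k (f r) x y)"
  using dx_sum_mult[where f = "\<lambda>r x y. y $ r" and g = f and A = UNIV and x = x and y = y and k = k] assms by (simp add: dx_component)

text \<open>The additional term \<open>f k\<close>, from differentiating the component of
  \<open>y\<close>, is what lowers the degree by one when Euler identities are differentiated; for
  \<open>dx\<close> the factor \<open>y\<close> is a constant.\<close>

lemma dy_contract:
  assumes "\<And>r. ydiff (f r) x y"
  shows "dy k (\<lambda>x y. \<Sum>r\<in>UNIV. y $ r * f r x y) x y = f k x y + (\<Sum>r\<in>UNIV. y $ r * dy k (f r) x y)"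
  using dy_sum_mult[where f = "\<lambda>r x y. y $ r" and g = f and A = UNIV and x = x and y = y and k = k, OF ydiff_component assms]
  by (simp add: dy_component if_distrib[of "\<lambda>c. c * _"] cong: if_cong)

lemma frechet_derivative_eq_sum_dy:
  assumes "ydiff f x y"
  shows "frechet_derivative (f x) (at y) v = (\<Sum>r\<in>UNIV. v $ r * dy r f x y)"
proof -
  interpret linear "frechet_derivative (f x) (at y)"
    using assms by (rule linear_frechet_derivative)
  have "v = (\<Sum>r\<in>UNIV. v $ r *\<^sub>R axis r 1)"
    using basis_expansion[of v] by (simp add: scalar_mult_eq_scaleR)
  then have "frechet_derivative (f x) (at y) v = frechet_derivative (f x) (at y) (\<Sum>r\<in>UNIV. v $ r *\<^sub>R axis r 1)"
    by simp
  then show ?thesis by (simp add: sum scale dy_def)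
qed

abbreviation smooth_field :: "(real^'n::finite) set \<Rightarrow> (real^'n \<Rightarrow> real^'n \<Rightarrow> real) \<Rightarrow> bool" where
  "smooth_field U f \<equiv> smooth_on (U \<times> - {0}) (\<lambda>(x, y). f x y)"

context
  fixes U :: "(real^'n::finite) set"
  assumes U: "open U"
begin

lemma open_field_domain: "open (U \<times> - {0 :: real^'n})"
  by (intro open_Times U open_Compl closed_singleton)

text \<open>Both partial derivatives are directional derivatives of one function on the product, so
  a single symmetry theorem lets \<open>x\<close>- and \<open>y\<close>-derivatives commute in every
  combination.\<close>

lemma
  assumes f: "smooth_field U f" and x: "x \<in> U" and y: "y \<noteq> 0"
  shows smooth_xdiff: "xdiff f x y"
    and smooth_ydiff: "ydiff f x y"
    and dx_eq_product_derivative: "dx k f x y = frechet_derivative (\<lambda>(x, y). f x y) (at (x, y)) (axis k 1, 0)"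
    and dy_eq_product_derivative: "dy k f x y = frechet_derivative (\<lambda>(x, y). f x y) (at (x, y)) (0, axis k 1)"
proof -
  let ?f = "\<lambda>(x, y). f x y"
  have D: "(?f has_derivative frechet_derivative ?f (at (x, y))) (at (x, y))"
    using smooth_on_differentiable[OF f, of "(x, y)"] x y unfolding frechet_derivative_works by simp
  have "((\<lambda>x'. ?f (x', y)) has_derivative (\<lambda>h. frechet_derivative ?f (at (x, y)) (h, 0))) (at x)"
    by (rule has_derivative_compose[where f = "\<lambda>x'. (x', y)" and x = x and g = ?f, OF _ D]) (intro has_derivative_Pair has_derivative_ident has_derivative_const)
  then have X: "((\<lambda>x'. f x' y) has_derivative (\<lambda>h. frechet_derivative ?f (at (x, y)) (h, 0))) (at x)" by simp
  have "((\<lambda>y'. ?f (x, y')) has_derivative (\<lambda>h. frechet_derivative ?f (at (x, y)) (0, h))) (at y)"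
    by (rule has_derivative_compose[where f = "\<lambda>y'. (x, y')" and x = y and g = ?f, OF _ D]) (intro has_derivative_Pair has_derivative_ident has_derivative_const)
  then have Y: "((\<lambda>y'. f x y') has_derivative (\<lambda>h. frechet_derivative ?f (at (x, y)) (0, h))) (at y)" by simp
  show "xdiff f x y" "ydiff f x y" using X Y by (auto simp: differentiable_def)
  show "dx k f x y = frechet_derivative ?f (at (x, y)) (axis k 1, 0)" by (rule dx_eqI[where f = f, OF X])
  show "dy k f x y = frechet_derivative ?f (at (x, y)) (0, axis k 1)" by (rule dy_eqI[where f = f, OF Y])
qed

lemma smooth_field_dx:
  assumes "smooth_field U f" shows "smooth_field U (dx k f)"
proof (rule smooth_on_cong[OF open_field_domain])
  show "smooth_on (U \<times> - {0}) (\<lambda>z. frechet_derivative (\<lambda>(x, y). f x y) (at z) (axis k 1, 0))"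
    by (rule smooth_on_derivative[OF assms])
  show "frechet_derivative (\<lambda>(x, y). f x y) (at z) (axis k 1, 0) = (case z of (x, y) \<Rightarrow> dx k f x y)"
    if "z \<in> U \<times> - {0}" for z
    using that dx_eq_product_derivative[OF assms, of "fst z" "snd z" k] by (simp add: case_prod_beta mem_Times_iff)
qed

lemma smooth_field_dy:
  assumes "smooth_field U f" shows "smooth_field U (dy k f)"
proof (rule smooth_on_cong[OF open_field_domain])
  show "smooth_on (U \<times> - {0}) (\<lambda>z. frechet_derivative (\<lambda>(x, y). f x y) (at z) (0, axis k 1))"
    by (rule smooth_on_derivative[OF assms])
  show "frechet_derivative (\<lambda>(x, y). f x y) (at z) (0, axis k 1) = (case z of (x, y) \<Rightarrow> dy k f x y)"
    if "z \<in> U \<times> - {0}" for z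
    using that dy_eq_product_derivative[OF assms, of "fst z" "snd z" k] by (simp add: case_prod_beta mem_Times_iff)
qed

lemma
  assumes f: "smooth_field U f" and xy: "x \<in> U" "y \<noteq> 0"
  shows dx_dx_commute: "dx k (dx l f) x y = dx l (dx k f) x y"
    and dx_dy_commute: "dx k (dy l f) x y = dy l (dx k f) x y"
    and dy_dy_commute: "dy k (dy l f) x y = dy l (dy k f) x y"
proof -
  let ?D = "\<lambda>v z. frechet_derivative (\<lambda>(x, y). f x y) (at z) v"
  have DX: "frechet_derivative (\<lambda>(x, y). dx k f x y) (at (x, y)) = frechet_derivative (?D (axis k 1, 0)) (at (x, y))" for k
    by (rule frechet_derivative_cong_open[OF open_field_domain]) (use xy in \<open>auto intro: dx_eq_product_derivative[OF f]\<close>)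
  have DY: "frechet_derivative (\<lambda>(x, y). dy k f x y) (at (x, y)) = frechet_derivative (?D (0, axis k 1)) (at (x, y))" for k
    by (rule frechet_derivative_cong_open[OF open_field_domain]) (use xy in \<open>auto intro: dy_eq_product_derivative[OF f]\<close>)
  have comm: "frechet_derivative (?D u) (at (x, y)) v = frechet_derivative (?D v) (at (x, y)) u" for u v
    by (rule mixed_derivatives_commute[OF open_field_domain f]) (use xy in auto)
  note eqs = dx_eq_product_derivative[OF smooth_field_dx[OF f] xy] dx_eq_product_derivative[OF smooth_field_dy[OF f] xy]
    dy_eq_product_derivative[OF smooth_field_dx[OF f] xy] dy_eq_product_derivative[OF smooth_field_dy[OF f] xy] DX DY
  show "dx k (dx l f) x y = dx l (dx k f) x y" "dx k (dy l f) x y = dy l (dx k f) x y"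
    "dy k (dy l f) x y = dy l (dy k f) x y"
    unfolding eqs by (rule comm)+
qed

end

text \<open>The Leibniz formula is a finite sum of products of entries. With Cramer's rule this
  replaces differentiating a matrix inverse.\<close>

lemma det_differentiable:
  fixes M :: "'a::real_normed_vector \<Rightarrow> real^'n^'n::finite"
  assumes "\<And>i j. (\<lambda>x. M x $ i $ j) differentiable at x"
  shows "(\<lambda>x. det (M x)) differentiable at x"
proof -
  have "(\<lambda>x. \<Prod>i\<in>UNIV. M x $ i $ p i) differentiable at x" for p
    unfolding differentiable_def
    using has_derivative_prod[of UNIV "\<lambda>i x. M x $ i $ p i", OF assms[unfolded frechet_derivative_works]] by blast
  then show ?thesis unfolding det_def by simp
qed

section \<open>Finsler and Berwald charts\<close>

lemma hderiv_cong:
  assumes "open U" "x \<in> U" "y \<noteq> 0" "\<And>x y. x \<in> U \<Longrightarrow> y \<noteq> 0 \<Longrightarrow> f x y = g x y"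
  shows "hderiv L k f x y = hderiv L k g x y"
proof -
  have "dx k f x y = dx k g x y" by (rule dx_cong[OF assms(1,2)]) (use assms in auto)
  moreover have "dy j f x y = dy j g x y" for j by (rule dy_cong) (use assms in auto)
  ultimately show ?thesis by (simp add: hderiv_def)
qed

text \<open>Both the formal Christoffel symbols and the Chern coefficients are \<open>1/2 g^is (T_kjs + T_jks - T_sjk)\<close>
  with \<open>T_kjs\<close> some derivative of \<open>g_js\<close> in direction \<open>k\<close>.\<close>

lemma christoffel_contract:
  fixes y :: "real^'n::finite" and T :: "'n \<Rightarrow> 'n \<Rightarrow> 'n \<Rightarrow> real"
  assumes T: "\<And>k s. (\<Sum>j\<in>UNIV. y $ j * T k j s) = 1/2 * B k s"
  shows "(\<Sum>j\<in>UNIV. \<Sum>k\<in>UNIV. (1/2 * (\<Sum>s\<in>UNIV. G s * (T k j s + T j k s - T s j k))) * y $ j * y $ k)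
    = 1/2 * (\<Sum>s\<in>UNIV. G s * ((\<Sum>k\<in>UNIV. y $ k * B k s) - 1/2 * (\<Sum>k\<in>UNIV. y $ k * B s k)))"
proof -
  have 1: "(\<Sum>j\<in>UNIV. \<Sum>k\<in>UNIV. T k j s * y $ j * y $ k) = 1/2 * (\<Sum>k\<in>UNIV. y $ k * B k s)" for s
  proof -
    have "(\<Sum>j\<in>UNIV. \<Sum>k\<in>UNIV. T k j s * y $ j * y $ k) = (\<Sum>k\<in>UNIV. \<Sum>j\<in>UNIV. T k j s * y $ j * y $ k)"
      by (rule sum.swap)
    also have "\<dots> = (\<Sum>k\<in>UNIV. y $ k * (\<Sum>j\<in>UNIV. y $ j * T k j s))"
      by (simp add: sum_distrib_left mult_ac)
    finally show ?thesis by (simp add: T sum_distrib_left mult_ac)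
  qed
  have 2: "(\<Sum>j\<in>UNIV. \<Sum>k\<in>UNIV. T j k s * y $ j * y $ k) = 1/2 * (\<Sum>k\<in>UNIV. y $ k * B k s)" for s
    using 1[of s] by (subst sum.swap) (simp add: mult_ac)
  have 3: "(\<Sum>j\<in>UNIV. \<Sum>k\<in>UNIV. T s j k * y $ j * y $ k) = 1/2 * (\<Sum>k\<in>UNIV. y $ k * B s k)" for s
  proof -
    have "(\<Sum>j\<in>UNIV. \<Sum>k\<in>UNIV. T s j k * y $ j * y $ k) = (\<Sum>k\<in>UNIV. \<Sum>j\<in>UNIV. T s j k * y $ j * y $ k)"
      by (rule sum.swap)
    also have "\<dots> = (\<Sum>k\<in>UNIV. y $ k * (\<Sum>j\<in>UNIV. y $ j * T s j k))"
      by (simp add: sum_distrib_left mult_ac)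
    finally show ?thesis by (simp add: T sum_distrib_left mult_ac)
  qed
  have "(\<Sum>j\<in>UNIV. \<Sum>k\<in>UNIV. (1/2 * (\<Sum>s\<in>UNIV. G s * (T k j s + T j k s - T s j k))) * y $ j * y $ k)
    = (\<Sum>j\<in>UNIV. \<Sum>k\<in>UNIV. \<Sum>s\<in>UNIV. 1/2 * G s * ((T k j s + T j k s - T s j k) * y $ j * y $ k))"
    by (simp add: sum_distrib_left sum_distrib_right mult_ac)
  also have "\<dots> = (\<Sum>j\<in>UNIV. \<Sum>s\<in>UNIV. \<Sum>k\<in>UNIV. 1/2 * G s * ((T k j s + T j k s - T s j k) * y $ j * y $ k))"
    by (intro sum.cong refl sum.swap)
  also have "\<dots> = (\<Sum>s\<in>UNIV. \<Sum>j\<in>UNIV. \<Sum>k\<in>UNIV. 1/2 * G s * ((T k j s + T j k s - T s j k) * y $ j * y $ k))"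
    by (rule sum.swap)
  also have "\<dots> = (\<Sum>s\<in>UNIV. 1/2 * G s * (\<Sum>j\<in>UNIV. \<Sum>k\<in>UNIV. T k j s * y $ j * y $ k + T j k s * y $ j * y $ k - T s j k * y $ j * y $ k))"
    by (simp add: sum_distrib_left left_diff_distrib distrib_right)
  also have "\<dots> = (\<Sum>s\<in>UNIV. 1/2 * G s * ((\<Sum>k\<in>UNIV. y $ k * B k s) - 1/2 * (\<Sum>k\<in>UNIV. y $ k * B s k)))"
    by (simp add: sum.distrib sum_subtractf 1 2 3)
  also have "\<dots> = 1/2 * (\<Sum>s\<in>UNIV. G s * ((\<Sum>k\<in>UNIV. y $ k * B k s) - 1/2 * (\<Sum>k\<in>UNIV. y $ k * B s k)))"
    by (simp add: sum_distrib_left mult.assoc)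
  finally show ?thesis .
qed

section \<open>Euler identities and the spray in a Finsler chart\<close>

locale finsler_chart =
  fixes U :: "(real^'n::finite) set" and L :: "real^'n \<Rightarrow> real^'n \<Rightarrow> real"
  assumes U: "open U"
    and smooth_L: "smooth_field U L"
    and hom_L: "x \<in> U \<Longrightarrow> r > 0 \<Longrightarrow> L x (r *\<^sub>R y) = r * L x y"
    and pos_L: "x \<in> U \<Longrightarrow> y \<noteq> 0 \<Longrightarrow> L x y > 0"
    and posdef: "x \<in> U \<Longrightarrow> y \<noteq> 0 \<Longrightarrow> u \<noteq> 0 \<Longrightarrow> u \<bullet> (fund_matrix L x y *v u) > 0"
begin

definition E :: "real^'n \<Rightarrow> real^'n \<Rightarrow> real" where "E = (\<lambda>x y. (L x y)\<^sup>2)"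

lemma smooth_E: "smooth_field U E"
proof -
  have "smooth_on (U \<times> - {0}) (\<lambda>z. (case z of (x, y) \<Rightarrow> L x y)\<^sup>2)"
    by (rule smooth_on_power2[OF open_field_domain[OF U] smooth_L])
  then show ?thesis
    unfolding E_def by (rule smooth_on_cong[OF open_field_domain[OF U], rotated]) auto
qed

lemmas smooth_intros = smooth_E smooth_field_dx[OF U] smooth_field_dy[OF U]
lemmas xdiff = smooth_xdiff[OF U] and ydiff = smooth_ydiff[OF U]

lemma fund_eq: "fund L i j = (\<lambda>x y. 1/2 * dy i (dy j E) x y)"
  by (simp add: fund_def E_def fun_eq_iff)

lemma L_zero: "x \<in> U \<Longrightarrow> L x 0 = 0"
  using hom_L[of x 2 0] by simp

lemma squared_norm_E:
  assumes x: "x \<in> U" shows "squared_norm (E x) (\<lambda>y. frechet_derivative (E x) (at y))"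
proof
  fix r :: real and y v :: "real^'n"
  show "E x (r *\<^sub>R y) = r\<^sup>2 * E x y" if "r > 0" using hom_L[OF x that] by (simp add: E_def power_mult_distrib)
  show "E x y > 0" if "y \<noteq> 0" using pos_L[OF x that] by (simp add: E_def)
  show "E x 0 = 0" using L_zero[OF x] by (simp add: E_def)
  show "(E x has_derivative frechet_derivative (E x) (at y)) (at y)" if "y \<noteq> 0"
    using ydiff[OF smooth_E x that] by (simp only: frechet_derivative_works)
  have "continuous_on (- {0}) (\<lambda>y. dy k E x y)" for k
    by (intro continuous_at_imp_continuous_on ballI differentiable_imp_continuous_within ydiff[OF _ x] smooth_intros) simp
  then have "continuous_on (- {0}) (\<lambda>y. \<Sum>k\<in>UNIV. v $ k * dy k E x y)"
    by (intro continuous_intros)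
  then show "continuous_on (- {0}) (\<lambda>y. frechet_derivative (E x) (at y) v)"
    by (rule continuous_on_eq) (use frechet_derivative_eq_sum_dy[where f = E, OF ydiff[OF smooth_E x]] in auto)
qed

lemma euler1:
  assumes "x \<in> U" "y \<noteq> 0" shows "(\<Sum>r\<in>UNIV. y $ r * dy r E x y) = 2 * E x y"
  using squared_norm.euler[OF squared_norm_E[OF assms(1)] assms(2)]
    frechet_derivative_eq_sum_dy[where f = E, OF ydiff[OF smooth_E assms], of y] by simp

text \<open>\<open>dy j E\<close> is homogeneous of degree 1: differentiate the identity of degree 2
  in \<open>y\<close> and commute the derivatives.\<close>

lemma euler2:
  assumes xy: "x \<in> U" "y \<noteq> 0" shows "(\<Sum>r\<in>UNIV. y $ r * dy r (dy j E) x y) = dy j E x y"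
proof -
  have "dy j (\<lambda>x y. \<Sum>r\<in>UNIV. y $ r * dy r E x y) x y = dy j (\<lambda>x y. 2 * E x y) x y"
    by (rule dy_cong[OF xy(2)]) (use euler1 xy in auto)
  then have "dy j E x y + (\<Sum>r\<in>UNIV. y $ r * dy j (dy r E) x y) = 2 * dy j E x y"
    by (simp add: dy_contract dy_scale ydiff[OF _ xy] smooth_intros)
  then show ?thesis by (simp add: dy_dy_commute[OF U smooth_E xy, of j])
qed

text \<open>The second \<open>y\<close>-derivatives of \<open>E\<close> have degree 0. Up to a
  constant this is the vanishing of the Cartan tensor contracted with \<open>y\<close>.\<close>

lemma euler3:
  assumes xy: "x \<in> U" "y \<noteq> 0" shows "(\<Sum>r\<in>UNIV. y $ r * dy m (dy r (dy j E)) x y) = 0"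
proof -
  have "dy m (\<lambda>x y. \<Sum>r\<in>UNIV. y $ r * dy r (dy j E) x y) x y = dy m (dy j E) x y"
    by (rule dy_cong[OF xy(2)]) (use euler2 xy in auto)
  then show ?thesis by (simp add: dy_contract ydiff[OF _ xy] smooth_intros)
qed

lemma euler1_dx:
  assumes xy: "x \<in> U" "y \<noteq> 0" shows "(\<Sum>r\<in>UNIV. y $ r * dx k (dy r E) x y) = 2 * dx k E x y"
proof -
  have "dx k (\<lambda>x y. \<Sum>r\<in>UNIV. y $ r * dy r E x y) x y = dx k (\<lambda>x y. 2 * E x y) x y"
    by (rule dx_cong[OF U xy(1)]) (use euler1 xy in auto)
  then show ?thesis by (simp add: dx_contract dx_scale xdiff[OF _ xy] smooth_intros)
qed

lemma euler2_dx:
  assumes xy: "x \<in> U" "y \<noteq> 0" shows "(\<Sum>r\<in>UNIV. y $ r * dx k (dy r (dy j E)) x y) = dx k (dy j E) x y"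
proof -
  have "dx k (\<lambda>x y. \<Sum>r\<in>UNIV. y $ r * dy r (dy j E) x y) x y = dx k (dy j E) x y"
    by (rule dx_cong[OF U xy(1)]) (use euler2 xy in auto)
  then show ?thesis by (simp add: dx_contract xdiff[OF _ xy] smooth_intros)
qed

lemma fund_sym: "x \<in> U \<Longrightarrow> y \<noteq> 0 \<Longrightarrow> fund L i j x y = fund L j i x y"
  unfolding fund_eq using dy_dy_commute[OF U smooth_E] by metis

lemma fund_contract: "x \<in> U \<Longrightarrow> y \<noteq> 0 \<Longrightarrow> (\<Sum>r\<in>UNIV. y $ r * fund L r j x y) = 1/2 * dy j E x y"
  using euler2[of x y j] by (simp add: fund_eq sum_divide_distrib[symmetric])

lemma dx_fund: "x \<in> U \<Longrightarrow> y \<noteq> 0 \<Longrightarrow> dx k (fund L i j) x y = 1/2 * dx k (dy i (dy j E)) x y"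
  unfolding fund_eq by (intro dx_scale xdiff smooth_intros)

lemma dy_fund: "x \<in> U \<Longrightarrow> y \<noteq> 0 \<Longrightarrow> dy k (fund L i j) x y = 1/2 * dy k (dy i (dy j E)) x y"
  unfolding fund_eq by (intro dy_scale ydiff smooth_intros)

lemma dx_fund_contract:
  "x \<in> U \<Longrightarrow> y \<noteq> 0 \<Longrightarrow> (\<Sum>j\<in>UNIV. y $ j * dx k (fund L j s) x y) = 1/2 * dx k (dy s E) x y"
  using euler2_dx[of x y k s] by (simp add: dx_fund sum_divide_distrib[symmetric])

lemma dy_fund_contract: "x \<in> U \<Longrightarrow> y \<noteq> 0 \<Longrightarrow> (\<Sum>j\<in>UNIV. y $ j * dy m (fund L j s) x y) = 0"
  using euler3[of x y m s] by (simp add: dy_fund sum_divide_distrib[symmetric])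

text \<open>The vertical part of the horizontal derivative differentiates \<open>fund\<close> in
  \<open>y\<close>, and contraction with \<open>y\<close> kills it. Hence horizontal and plain
  \<open>x\<close>-derivatives of \<open>fund\<close> have the same contraction, which lets the
  Chern coefficients and the formal Christoffel symbols define the same spray.\<close>

lemma hderiv_fund_contract:
  assumes "x \<in> U" "y \<noteq> 0"
  shows "(\<Sum>j\<in>UNIV. y $ j * hderiv L k (fund L j s) x y) = 1/2 * dx k (dy s E) x y"
proof -
  have "(\<Sum>j\<in>UNIV. y $ j * (\<Sum>m\<in>UNIV. nonlin_conn L m k x y * dy m (fund L j s) x y)) =
      (\<Sum>j\<in>UNIV. \<Sum>m\<in>UNIV. nonlin_conn L m k x y * (y $ j * dy m (fund L j s) x y))"
    by (simp add: sum_distrib_left mult_ac)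
  also have "\<dots> = (\<Sum>m\<in>UNIV. nonlin_conn L m k x y * (\<Sum>j\<in>UNIV. y $ j * dy m (fund L j s) x y))"
    by (subst sum.swap) (simp add: sum_distrib_left)
  also have "\<dots> = 0" by (simp add: dy_fund_contract[OF assms])
  finally show ?thesis
    using dx_fund_contract[OF assms, of k s] by (simp add: hderiv_def right_diff_distrib sum_subtractf)
qed

lemma spray_eq_fund_inv:
  assumes "x \<in> U" "y \<noteq> 0"
  shows "spray L i x y = 1/2 * (\<Sum>s\<in>UNIV. fund_inv L i s x y *
    ((\<Sum>k\<in>UNIV. y $ k * dx k (dy s E) x y) - dx s E x y))"
proof -
  have "spray L i x y = 1/2 * (\<Sum>s\<in>UNIV. fund_inv L i s x y *
      ((\<Sum>k\<in>UNIV. y $ k * dx k (dy s E) x y) - 1/2 * (\<Sum>k\<in>UNIV. y $ k * dx s (dy k E) x y)))"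
    unfolding spray_def formal_christoffel_def
    by (rule christoffel_contract) (rule dx_fund_contract[OF assms])
  then show ?thesis by (simp add: euler1_dx[OF assms])
qed

text \<open>For \<open>y\<close>-independent Chern coefficients this makes the spray a quadratic
  form in \<open>y\<close>.\<close>

lemma chern_contract:
  assumes "x \<in> U" "y \<noteq> 0"
  shows "(\<Sum>j\<in>UNIV. \<Sum>k\<in>UNIV. chern L i j k x y * y $ j * y $ k) = spray L i x y"
proof -
  have "(\<Sum>j\<in>UNIV. \<Sum>k\<in>UNIV. chern L i j k x y * y $ j * y $ k) = 1/2 * (\<Sum>s\<in>UNIV. fund_inv L i s x y *
      ((\<Sum>k\<in>UNIV. y $ k * dx k (dy s E) x y) - 1/2 * (\<Sum>k\<in>UNIV. y $ k * dx s (dy k E) x y)))"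
    unfolding chern_def by (rule christoffel_contract) (rule hderiv_fund_contract[OF assms])
  then show ?thesis by (simp add: euler1_dx[OF assms] spray_eq_fund_inv[OF assms])
qed

lemma chern_sym:
  assumes "x \<in> U" "y \<noteq> 0" shows "chern L i j k x y = chern L i k j x y"
proof -
  have "hderiv L s (fund L j k) x y = hderiv L s (fund L k j) x y" for s
    by (rule hderiv_cong[OF U assms]) (rule fund_sym)
  then show ?thesis by (simp add: chern_def add.commute)
qed

lemma invertible_fund_matrix:
  assumes "x \<in> U" "y \<noteq> 0" shows "invertible (fund_matrix L x y)"
proof -
  have "u = 0" if "fund_matrix L x y *v u = 0" for u
    using posdef[OF assms, of u] that by (cases "u = 0") auto
  then show ?thesis by (simp add: invertible_left_inverse matrix_left_invertible_ker)
qed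

text \<open>Lowering the index removes the matrix inverse; the right-hand side is half of the
  acceleration-free part of the Euler-Lagrange expression of \<open>E\<close>.\<close>

lemma fund_matrix_spray:
  assumes "x \<in> U" "y \<noteq> 0"
  shows "fund_matrix L x y *v (\<chi> i. spray L i x y)
    = (\<chi> i. 1/2 * ((\<Sum>k\<in>UNIV. y $ k * dx k (dy i E) x y) - dx i E x y))"
proof -
  let ?b = "\<chi> i. 1/2 * ((\<Sum>k\<in>UNIV. y $ k * dx k (dy i E) x y) - dx i E x y)"
  have "(\<chi> i. spray L i x y) = matrix_inv (fund_matrix L x y) *v ?b"
    by (simp add: vec_eq_iff matrix_vector_mult_def spray_eq_fund_inv[OF assms] fund_inv_def sum_distrib_left mult_ac)
  moreover have "fund_matrix L x y ** matrix_inv (fund_matrix L x y) = mat 1"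
    using someI_ex[OF invertible_fund_matrix[OF assms, unfolded invertible_def]] by (simp add: matrix_inv_def)
  ultimately show ?thesis by (simp add: matrix_vector_mul_assoc)
qed

lemma fund_spray:
  assumes "x \<in> U" "y \<noteq> 0"
  shows "(\<Sum>s\<in>UNIV. fund L i s x y * spray L s x y)
    = 1/2 * ((\<Sum>k\<in>UNIV. y $ k * dx k (dy i E) x y) - dx i E x y)"
  using arg_cong[OF fund_matrix_spray[OF assms], of "\<lambda>v. v $ i"]
  by (simp add: matrix_vector_mult_def fund_matrix_def)

text \<open>The spray solves the linear system \<open>fund_matrix_spray\<close>, so Cramer's rule
  expresses it by determinants whose entries are differentiable in \<open>x\<close>.\<close>

lemma xdiff_spray:
  assumes xy: "x \<in> U" "y \<noteq> 0"
  shows "xdiff (spray L i) x y"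
proof -
  define b where "b x = (\<chi> i. 1/2 * ((\<Sum>k\<in>UNIV. y $ k * dx k (dy i E) x y) - dx i E x y))" for x
  \<comment> \<open>The matrix of the system with column \<open>i\<close> replaced by the right-hand
    side.\<close>
  define M where "M x = (\<chi> r c. if c = i then b x $ r else fund_matrix L x y $ r $ c)" for x
  have eq: "det (M x) / det (fund_matrix L x y) = spray L i x y" if "x \<in> U" for x
  proof -
    have det: "det (fund_matrix L x y) \<noteq> 0"
      using invertible_fund_matrix[OF that xy(2)] by (simp add: invertible_det_nz)
    have "fund_matrix L x y *v (\<chi> i. spray L i x y) = b x"
      unfolding b_def by (rule fund_matrix_spray[OF that xy(2)])
    then have "(\<chi> i. spray L i x y) = (\<chi> k. det (\<chi> r c. if c = k then b x $ r else fund_matrix L x y $ r $ c)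
        / det (fund_matrix L x y))"
      using cramer[OF det] by blast
    from arg_cong[OF this, of "\<lambda>v. v $ i"] show ?thesis by (simp add: M_def)
  qed
  have fund: "xdiff (fund L r c) x y" for r c
    unfolding fund_eq by (intro differentiable_mult differentiable_const xdiff[OF _ xy] smooth_intros)
  have b: "(\<lambda>x. b x $ r) differentiable at x" for r
    unfolding b_def
    by (simp, intro differentiable_divide differentiable_diff differentiable_sum differentiable_mult differentiable_const
        ballI xdiff[OF _ xy] smooth_intros) simp_all
  have "(\<lambda>x. det (M x)) differentiable at x"
  proof (rule det_differentiable)
    show "(\<lambda>x. M x $ r $ c) differentiable at x" for r c
      using fund b by (cases "c = i") (simp_all add: M_def fund_matrix_def)
  qed
  moreover have "(\<lambda>x. det (fund_matrix L x y)) differentiable at x"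
    by (rule det_differentiable) (simp add: fund_matrix_def fund)
  ultimately have "(\<lambda>x. det (M x) / det (fund_matrix L x y)) differentiable at x"
    using invertible_fund_matrix[OF xy] by (intro differentiable_divide) (simp_all add: invertible_det_nz)
  then show ?thesis by (rule differentiable_cong_open[OF _ U xy(1)]) (rule eq)
qed

end

lemma curv_up_antisym: "curv_up L j i l k x y = - curv_up L j i k l x y"
  by (simp add: curv_up_def)

section \<open>Parallelism of the norm and the curvature identity in a Berwald chart\<close>

locale berwald_chart = finsler_chart U L
  for U :: "(real^'n::finite) set" and L :: "real^'n \<Rightarrow> real^'n \<Rightarrow> real" +
  assumes chern_const: "x \<in> U \<Longrightarrow> y \<noteq> 0 \<Longrightarrow> z \<noteq> 0 \<Longrightarrow> chern L i j k x y = chern L i j k x z"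
begin

text \<open>A fixed nonzero vector at which the \<open>y\<close>-independent coefficients are read
  off; at the zero vector the Chern coefficients carry no information.\<close>

definition base_vec :: "real^'n" where "base_vec = (\<chi> i. 1)"

lemma base_vec_nz: "base_vec \<noteq> 0" by (simp add: base_vec_def vec_eq_iff)

definition conn :: "'n \<Rightarrow> 'n \<Rightarrow> 'n \<Rightarrow> real^'n \<Rightarrow> real" where
  "conn i j k x = chern L i j k x base_vec"

lemma chern_eq: "x \<in> U \<Longrightarrow> y \<noteq> 0 \<Longrightarrow> chern L i j k x y = conn i j k x"
  unfolding conn_def using chern_const base_vec_nz by blast

lemma conn_sym: "x \<in> U \<Longrightarrow> conn i j k x = conn i k j x"
  unfolding conn_def using chern_sym base_vec_nz by blast

lemma spray_eq: "x \<in> U \<Longrightarrow> y \<noteq> 0 \<Longrightarrow> spray L i x y = (\<Sum>j\<in>UNIV. \<Sum>k\<in>UNIV. conn i j k x * y $ j * y $ k)"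
  using chern_contract[of x y i] by (simp add: chern_eq)

text \<open>By \<open>dy_spray\<close> this is the nonlinear connection \<open>nonlin_conn\<close>
  off the origin, in a form visibly linear in \<open>y\<close>.\<close>

definition N :: "'n \<Rightarrow> 'n \<Rightarrow> real^'n \<Rightarrow> real^'n \<Rightarrow> real" where
  "N i j x y = (\<Sum>k\<in>UNIV. y $ k * conn i j k x)"

lemma spray_eq_N: "x \<in> U \<Longrightarrow> y \<noteq> 0 \<Longrightarrow> spray L i x y = (\<Sum>j\<in>UNIV. y $ j * N i j x y)"
  by (simp add: spray_eq N_def sum_distrib_left mult_ac)

lemma dy_N: "dy m (N i j) x y = conn i j m x"
  using dy_contract[of "\<lambda>k x y. conn i j k x" x y m] by (simp add: N_def[abs_def] dy_def)

lemma ydiff_N: "ydiff (N i j) x y"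
  unfolding N_def by (intro differentiable_sum differentiable_mult ballI differentiable_const ydiff_component) simp

lemma ydiff_spray:
  assumes "x \<in> U" "y \<noteq> 0" shows "ydiff (spray L i) x y"
proof -
  have "(\<lambda>y. \<Sum>j\<in>UNIV. y $ j * N i j x y) differentiable at y"
    by (intro differentiable_sum differentiable_mult ballI ydiff_N ydiff_component) simp
  then show ?thesis
    by (rule differentiable_cong_open[of _ _ "- {0}"])
      (use assms spray_eq_N in \<open>auto simp: open_Compl[OF closed_singleton]\<close>)
qed

lemma dy_spray:
  assumes "x \<in> U" "y \<noteq> 0" shows "dy m (spray L i) x y = 2 * N i m x y"
proof -
  have "dy m (spray L i) x y = dy m (\<lambda>x y. \<Sum>j\<in>UNIV. y $ j * N i j x y) x y"
    by (rule dy_cong) (use assms spray_eq_N in auto)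
  also have "\<dots> = N i m x y + (\<Sum>j\<in>UNIV. y $ j * conn i j m x)"
    by (simp add: dy_contract ydiff_N dy_N)
  also have "(\<Sum>j\<in>UNIV. y $ j * conn i j m x) = N i m x y"
    unfolding N_def by (intro sum.cong refl) (simp add: conn_sym[OF assms(1), of i _ m])
  finally show ?thesis by simp
qed

text \<open>Infinitesimally, parallel transport preserves the Finsler norm.\<close>

lemma dx_E:
  assumes xy: "x \<in> U" "y \<noteq> 0"
  shows "dx k E x y = (\<Sum>s\<in>UNIV. N s k x y * dy s E x y)"
proof -
  \<comment> \<open>\<open>E\<close> is constant along the spray: write \<open>dy s E\<close> as
    twice the contraction of \<open>fund\<close> with \<open>y\<close>, lower the spray by
    \<open>fund_spray\<close>, and apply the Euler identity.\<close>
  have contract: "(\<Sum>s\<in>UNIV. dy s E x y * spray L s x y) = (\<Sum>r\<in>UNIV. y $ r * dx r E x y)" if y: "y \<noteq> 0" for y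
  proof -
    have "(\<Sum>s\<in>UNIV. dy s E x y * spray L s x y) = (\<Sum>s\<in>UNIV. 2 * (\<Sum>i\<in>UNIV. y $ i * fund L i s x y) * spray L s x y)"
      by (simp add: fund_contract[OF xy(1) y])
    also have "\<dots> = (\<Sum>s\<in>UNIV. \<Sum>i\<in>UNIV. 2 * y $ i * (fund L i s x y * spray L s x y))"
      by (simp add: sum_distrib_left sum_distrib_right mult_ac)
    also have "\<dots> = (\<Sum>i\<in>UNIV. 2 * y $ i * (\<Sum>s\<in>UNIV. fund L i s x y * spray L s x y))"
      by (subst sum.swap) (simp add: sum_distrib_left)
    also have "\<dots> = (\<Sum>i\<in>UNIV. y $ i * ((\<Sum>k\<in>UNIV. y $ k * dx k (dy i E) x y) - dx i E x y))"
      by (simp add: fund_spray[OF xy(1) y])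
    also have "\<dots> = (\<Sum>i\<in>UNIV. \<Sum>k\<in>UNIV. y $ k * (y $ i * dx k (dy i E) x y)) - (\<Sum>i\<in>UNIV. y $ i * dx i E x y)"
      by (simp add: right_diff_distrib sum_subtractf sum_distrib_left mult_ac)
    also have "(\<Sum>i\<in>UNIV. \<Sum>k\<in>UNIV. y $ k * (y $ i * dx k (dy i E) x y)) = (\<Sum>k\<in>UNIV. y $ k * (\<Sum>i\<in>UNIV. y $ i * dx k (dy i E) x y))"
      by (subst sum.swap) (simp add: sum_distrib_left)
    also have "\<dots> = 2 * (\<Sum>k\<in>UNIV. y $ k * dx k E x y)"
      by (simp add: euler1_dx[OF xy(1) y] sum_distrib_left mult_ac)
    finally show ?thesis by simp
  qed
  \<comment> \<open>Differentiating \<open>contract\<close> in direction \<open>k\<close> frees one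
    index. \<open>fund_spray\<close> evaluates the term with second derivatives of \<open>E\<close>,
    the mixed derivatives cancel, and both remaining terms appear with factor 2.\<close>
  have "dy k (\<lambda>x y. \<Sum>s\<in>UNIV. dy s E x y * spray L s x y) x y = dy k (\<lambda>x y. \<Sum>r\<in>UNIV. y $ r * dx r E x y) x y"
    by (rule dy_cong[OF xy(2)]) (rule contract)
  moreover have "dy k (\<lambda>x y. \<Sum>s\<in>UNIV. dy s E x y * spray L s x y) x y
      = (\<Sum>s\<in>UNIV. dy k (dy s E) x y * spray L s x y) + (\<Sum>s\<in>UNIV. dy s E x y * dy k (spray L s) x y)"
    by (rule dy_sum_mult) (intro ydiff[OF _ xy] ydiff_spray[OF xy] smooth_intros)+
  moreover have "dy k (\<lambda>x y. \<Sum>r\<in>UNIV. y $ r * dx r E x y) x y = dx k E x y + (\<Sum>r\<in>UNIV. y $ r * dy k (dx r E) x y)"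
    by (rule dy_contract) (intro ydiff[OF _ xy] smooth_intros)
  moreover have "(\<Sum>s\<in>UNIV. dy k (dy s E) x y * spray L s x y) = (\<Sum>r\<in>UNIV. y $ r * dx r (dy k E) x y) - dx k E x y"
    using fund_spray[OF xy, of k] by (simp add: fund_eq sum_divide_distrib[symmetric])
  moreover have "(\<Sum>s\<in>UNIV. dy s E x y * dy k (spray L s) x y) = 2 * (\<Sum>s\<in>UNIV. N s k x y * dy s E x y)"
    by (simp add: dy_spray[OF xy] sum_distrib_left mult_ac)
  ultimately show ?thesis
    by (simp add: dx_dy_commute[OF U smooth_E xy])
qed

text \<open>The spray is a quadratic form with symmetric coefficients \<open>conn\<close>. Only sums
  of basis vectors occur, which are nonzero even for \<open>j = k\<close>, so the spray is evaluated
  where it is meaningful. Its differentiability in \<open>x\<close> thereby passes to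
  \<open>conn\<close>.\<close>

lemma conn_polarization:
  assumes x: "x \<in> U"
  shows "conn i j k x = 1/2 * (spray L i x (axis j 1 + axis k 1) - spray L i x (axis j 1) - spray L i x (axis k 1))"
proof -
  define b where "b u v = (\<Sum>j\<in>UNIV. \<Sum>k\<in>UNIV. conn i j k x * u $ j * v $ k)" for u v :: "real^'n"
  have nz: "axis j 1 + axis k 1 \<noteq> (0 :: real^'n)" for j k
    by (auto simp: vec_eq_iff axis_def intro!: exI[of _ j])
  have b_axis: "b (axis j 1) (axis k 1) = conn i j k x" for j k
    by (simp add: b_def axis_def if_distrib[of "\<lambda>c. _ * c"] if_distrib[of "\<lambda>c. c * _"] cong: if_cong)
  have "b (u + v) (u + v) = b u u + b u v + b v u + b v v" for u v
    by (simp add: b_def distrib_left distrib_right sum.distrib)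
  then have "b (axis j 1 + axis k 1) (axis j 1 + axis k 1) - b (axis j 1) (axis j 1) - b (axis k 1) (axis k 1) = 2 * conn i j k x"
    by (simp add: b_axis conn_sym[OF x, of i k j])
  moreover have "spray L i x u = b u u" if "u \<noteq> 0" for u
    using spray_eq[OF x that] by (simp add: b_def)
  ultimately show ?thesis by (simp add: nz axis_eq_0_iff)
qed

lemma conn_differentiable:
  assumes x: "x \<in> U" shows "conn i j k differentiable at x"
proof -
  have nz: "axis j 1 + axis k 1 \<noteq> (0 :: real^'n)"
    by (auto simp: vec_eq_iff axis_def intro!: exI[of _ j])
  have "(\<lambda>x. 1/2 * (spray L i x (axis j 1 + axis k 1) - spray L i x (axis j 1) - spray L i x (axis k 1))) differentiable at x"
    by (intro differentiable_mult differentiable_diff differentiable_const xdiff_spray[OF x] nz) (simp_all add: axis_eq_0_iff)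
  then show ?thesis
    by (rule differentiable_cong_open[OF _ U x]) (rule conn_polarization[symmetric])
qed

definition dconn :: "'n \<Rightarrow> 'n \<Rightarrow> 'n \<Rightarrow> 'n \<Rightarrow> real^'n \<Rightarrow> real" where
  "dconn l i j k x = frechet_derivative (conn i j k) (at x) (axis l 1)"

text \<open>The vertical parts of the horizontal derivatives vanish on \<open>y\<close>-independent
  coefficients, leaving the curvature of an affine connection.\<close>

lemma curv_up_eq:
  assumes "x \<in> U" "y \<noteq> 0"
  shows "curv_up L j i k l x y = dconn k i j l x - dconn l i j k x
    + (\<Sum>h\<in>UNIV. conn i h k x * conn h j l x) - (\<Sum>h\<in>UNIV. conn i h l x * conn h j k x)"
proof -
  have "hderiv L m (chern L i j p) x y = dconn m i j p x" for m p
  proof -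
    have "hderiv L m (chern L i j p) x y = hderiv L m (\<lambda>x y. conn i j p x) x y"
      by (rule hderiv_cong[OF U assms]) (rule chern_eq)
    then show ?thesis by (simp add: hderiv_def dy_def dx_def dconn_def)
  qed
  then show ?thesis by (simp add: curv_up_def chern_eq[OF assms])
qed

lemma xdiff_N:
  assumes "x \<in> U" shows "xdiff (N i j) x y"
  unfolding N_def by (intro differentiable_sum differentiable_mult ballI differentiable_const conn_differentiable assms) simp

lemma dx_N:
  assumes "x \<in> U" shows "dx l (N i j) x y = (\<Sum>k\<in>UNIV. y $ k * dconn l i j k x)"
  using dx_contract[where f = "\<lambda>k x y. conn i j k x" and x = x and y = y and k = l] conn_differentiable[OF assms]
  by (simp add: N_def[abs_def] dx_def dconn_def)

text \<open>\<open>dx_E\<close> is used for the outer and, after commuting with \<open>dy\<close>,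
  for the inner derivative. The terms are grouped so that the last sum is symmetric in
  \<open>k\<close> and \<open>l\<close>, while the first two carry the curvature.\<close>

lemma dx_dx_E:
  assumes xy: "x \<in> U" "y \<noteq> 0"
  shows "dx l (dx k E) x y = (\<Sum>r\<in>UNIV. dx l (N r k) x y * dy r E x y)
    + (\<Sum>r\<in>UNIV. (\<Sum>j\<in>UNIV. N j k x y * conn r l j x) * dy r E x y)
    + (\<Sum>j\<in>UNIV. \<Sum>r\<in>UNIV. N j k x y * N r l x y * dy j (dy r E) x y)"
proof -
  have "dx l (dx k E) x y = dx l (\<lambda>x y. \<Sum>s\<in>UNIV. N s k x y * dy s E x y) x y"
    by (rule dx_cong[OF U xy(1)]) (rule dx_E[OF _ xy(2)])
  also have "\<dots> = (\<Sum>r\<in>UNIV. dx l (N r k) x y * dy r E x y) + (\<Sum>j\<in>UNIV. N j k x y * dx l (dy j E) x y)"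
    by (rule dx_sum_mult) (intro xdiff_N xdiff[OF _ xy] xy smooth_intros)+
  also have "(\<Sum>j\<in>UNIV. N j k x y * dx l (dy j E) x y) =
    (\<Sum>j\<in>UNIV. N j k x y * ((\<Sum>r\<in>UNIV. conn r l j x * dy r E x y) + (\<Sum>r\<in>UNIV. N r l x y * dy j (dy r E) x y)))"
  proof (intro sum.cong refl)
    fix j
    have "dx l (dy j E) x y = dy j (dx l E) x y" by (rule dx_dy_commute[OF U smooth_E xy])
    also have "\<dots> = dy j (\<lambda>x y. \<Sum>s\<in>UNIV. N s l x y * dy s E x y) x y"
      by (rule dy_cong[OF xy(2)]) (rule dx_E[OF xy(1)])
    also have "\<dots> = (\<Sum>r\<in>UNIV. dy j (N r l) x y * dy r E x y) + (\<Sum>r\<in>UNIV. N r l x y * dy j (dy r E) x y)"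
      by (rule dy_sum_mult) (intro ydiff_N ydiff[OF _ xy] smooth_intros)+
    finally show "N j k x y * dx l (dy j E) x y
      = N j k x y * ((\<Sum>r\<in>UNIV. conn r l j x * dy r E x y) + (\<Sum>r\<in>UNIV. N r l x y * dy j (dy r E) x y))"
      by (simp add: dy_N)
  qed
  also have "\<dots> = (\<Sum>j\<in>UNIV. \<Sum>r\<in>UNIV. N j k x y * conn r l j x * dy r E x y)
      + (\<Sum>j\<in>UNIV. \<Sum>r\<in>UNIV. N j k x y * N r l x y * dy j (dy r E) x y)"
    by (simp add: distrib_left sum.distrib sum_distrib_left mult.assoc)
  also have "(\<Sum>j\<in>UNIV. \<Sum>r\<in>UNIV. N j k x y * conn r l j x * dy r E x y)
      = (\<Sum>r\<in>UNIV. (\<Sum>j\<in>UNIV. N j k x y * conn r l j x) * dy r E x y)"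
    by (subst sum.swap) (simp add: sum_distrib_right)
  finally show ?thesis by simp
qed

text \<open>The left-hand side is the commutator of \<open>dx l\<close> and \<open>dx k\<close>
  applied to \<open>E\<close>, as computed by \<open>dx_dx_E\<close>.\<close>

lemma curvature_annihilates_E:
  assumes xy: "x \<in> U" "y \<noteq> 0"
  shows "(\<Sum>r\<in>UNIV. (\<Sum>s\<in>UNIV. y $ s * curv_up L s r l k x y) * dy r E x y) = 0"
proof -
  have sym: "(\<Sum>j\<in>UNIV. \<Sum>r\<in>UNIV. N j k x y * N r l x y * dy j (dy r E) x y)
      = (\<Sum>j\<in>UNIV. \<Sum>r\<in>UNIV. N j l x y * N r k x y * dy j (dy r E) x y)"
    by (subst sum.swap) (simp add: dy_dy_commute[OF U smooth_E xy] mult_ac)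
  have quad: "(\<Sum>s\<in>UNIV. y $ s * (\<Sum>h\<in>UNIV. conn r h m x * conn h s p x)) = (\<Sum>j\<in>UNIV. N j p x y * conn r m j x)" for r m p
  proof -
    have "(\<Sum>s\<in>UNIV. y $ s * (\<Sum>h\<in>UNIV. conn r h m x * conn h s p x))
        = (\<Sum>s\<in>UNIV. \<Sum>h\<in>UNIV. y $ s * conn h p s x * conn r m h x)"
      by (simp add: sum_distrib_left mult_ac conn_sym[OF xy(1), of r _ m] conn_sym[OF xy(1), of _ _ p])
    also have "\<dots> = (\<Sum>j\<in>UNIV. N j p x y * conn r m j x)"
      by (subst sum.swap) (simp add: N_def sum_distrib_right)
    finally show ?thesis .
  qed
  have "(\<Sum>s\<in>UNIV. y $ s * curv_up L s r l k x y)
    = (dx l (N r k) x y + (\<Sum>j\<in>UNIV. N j k x y * conn r l j x))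
      - (dx k (N r l) x y + (\<Sum>j\<in>UNIV. N j l x y * conn r k j x))" for r
  proof -
    have "(\<Sum>s\<in>UNIV. y $ s * curv_up L s r l k x y) = (\<Sum>s\<in>UNIV. y $ s * dconn l r s k x) - (\<Sum>s\<in>UNIV. y $ s * dconn k r s l x)
      + (\<Sum>s\<in>UNIV. y $ s * (\<Sum>h\<in>UNIV. conn r h l x * conn h s k x)) - (\<Sum>s\<in>UNIV. y $ s * (\<Sum>h\<in>UNIV. conn r h k x * conn h s l x))"
      by (simp add: curv_up_eq[OF xy] distrib_left right_diff_distrib sum.distrib sum_subtractf)
    \<comment> \<open>\<open>N\<close> contracts \<open>y\<close> with the last lower index of
      \<open>conn\<close>, the curvature with the middle one. Symmetry of the connection reconciles
      them, also after differentiation.\<close>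
    moreover have "frechet_derivative (conn r s p) (at x) = frechet_derivative (conn r p s) (at x)" for s p
      by (rule frechet_derivative_cong_open[OF U xy(1)]) (rule conn_sym)
    then have "dconn m r s p x = dconn m r p s x" for m s p
      by (simp only: dconn_def)
    ultimately show ?thesis by (simp add: quad dx_N[OF xy(1)])
  qed
  then have "(\<Sum>r\<in>UNIV. (\<Sum>s\<in>UNIV. y $ s * curv_up L s r l k x y) * dy r E x y)
    = dx l (dx k E) x y - dx k (dx l E) x y"
    using sym by (simp add: dx_dx_E[OF xy] left_diff_distrib distrib_right sum.distrib sum_subtractf)
  also have "\<dots> = 0" by (simp add: dx_dx_commute[OF U smooth_E xy])
  finally show ?thesis .
qed

end

section \<open>Curvature operators and flag curvature\<close>

context berwald_chart
begin

lemma curv_up_const: "x \<in> U \<Longrightarrow> y \<noteq> 0 \<Longrightarrow> z \<noteq> 0 \<Longrightarrow> curv_up L j i k l x y = curv_up L j i k l x z"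
  by (simp add: curv_up_eq)

text \<open>The curvature operator R(u, v) applied to \<open>z\<close>. Evaluating the curvature at
  \<open>base_vec\<close> instead of \<open>z\<close> makes it linear in \<open>z\<close> on the
  whole space.\<close>

definition curv_map :: "real^'n \<Rightarrow> real^'n \<Rightarrow> real^'n \<Rightarrow> real^'n \<Rightarrow> real^'n" where
  "curv_map x u v z =
     (\<chi> i. \<Sum>j\<in>UNIV. z $ j * (\<Sum>k\<in>UNIV. \<Sum>l\<in>UNIV. curv_up L j i k l x base_vec * u $ k * v $ l))"

lemma linear_curv_map: "linear (curv_map x u v)"
  by (rule linearI)
    (simp_all add: curv_map_def vec_eq_iff distrib_right sum.distrib sum_distrib_left mult.assoc)

lemma linear_curv_map_direction: "linear (\<lambda>u. curv_map x u v z)"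
  by (rule linearI)
    (simp_all add: curv_map_def vec_eq_iff distrib_left distrib_right sum.distrib sum_distrib_left mult_ac)

lemma curv_map_same: "curv_map x v v z = 0"
proof -
  have "(\<Sum>k\<in>UNIV. \<Sum>l\<in>UNIV. curv_up L j i k l x base_vec * v $ k * v $ l) = 0" (is "?S = 0") for i j
  proof -
    have "?S = (\<Sum>k\<in>UNIV. \<Sum>l\<in>UNIV. curv_up L j i l k x base_vec * v $ l * v $ k)"
      by (rule sum.swap)
    also have "\<dots> = - ?S"
      unfolding sum_negf[symmetric]
      by (intro sum.cong refl) (simp add: curv_up_antisym[of L j i _ _ x base_vec, THEN sym] curv_up_def algebra_simps)
    finally show ?thesis by simp
  qed
  then show ?thesis by (simp add: curv_map_def vec_eq_iff)
qed

text \<open>Off the origin the curvature at \<open>base_vec\<close> equals the one at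
  \<open>y\<close>, so this is \<open>curvature_annihilates_E\<close> contracted with
  \<open>u\<close> and \<open>v\<close>.\<close>

lemma curv_map_invariant:
  assumes xy: "x \<in> U" "y \<noteq> 0"
  shows "frechet_derivative (E x) (at y) (curv_map x u v y) = 0"
proof -
  have "frechet_derivative (E x) (at y) (curv_map x u v y) = (\<Sum>r\<in>UNIV. (curv_map x u v y) $ r * dy r E x y)"
    by (rule frechet_derivative_eq_sum_dy[where f = E, OF ydiff[OF smooth_E xy]])
  also have "\<dots> = (\<Sum>r\<in>UNIV. (\<Sum>k\<in>UNIV. \<Sum>l\<in>UNIV. u $ k * v $ l * ((\<Sum>j\<in>UNIV. y $ j * curv_up L j r k l x y) * dy r E x y)))"
  proof (intro sum.cong refl)
    fix r
    have "(curv_map x u v y) $ r = (\<Sum>j\<in>UNIV. \<Sum>k\<in>UNIV. \<Sum>l\<in>UNIV. u $ k * v $ l * (y $ j * curv_up L j r k l x y))"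
      by (simp add: curv_map_def sum_distrib_left mult_ac curv_up_const[OF xy base_vec_nz])
    also have "\<dots> = (\<Sum>k\<in>UNIV. \<Sum>j\<in>UNIV. \<Sum>l\<in>UNIV. u $ k * v $ l * (y $ j * curv_up L j r k l x y))"
      by (rule sum.swap)
    also have "\<dots> = (\<Sum>k\<in>UNIV. \<Sum>l\<in>UNIV. u $ k * v $ l * (\<Sum>j\<in>UNIV. y $ j * curv_up L j r k l x y))"
      unfolding sum_distrib_left by (intro sum.cong refl sum.swap)
    finally show "(curv_map x u v y) $ r * dy r E x y = (\<Sum>k\<in>UNIV. \<Sum>l\<in>UNIV. u $ k * v $ l * ((\<Sum>j\<in>UNIV. y $ j * curv_up L j r k l x y) * dy r E x y))"
      by (simp add: sum_distrib_right mult.assoc)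
  qed
  also have "\<dots> = (\<Sum>k\<in>UNIV. \<Sum>l\<in>UNIV. u $ k * v $ l * (\<Sum>r\<in>UNIV. (\<Sum>j\<in>UNIV. y $ j * curv_up L j r k l x y) * dy r E x y))"
  proof -
    have swap3: "(\<Sum>r\<in>UNIV. \<Sum>k\<in>UNIV. \<Sum>l\<in>UNIV. f r k l) = (\<Sum>k\<in>UNIV. \<Sum>l\<in>UNIV. \<Sum>r\<in>UNIV. f r k l)"
      for f :: "'n \<Rightarrow> 'n \<Rightarrow> 'n \<Rightarrow> real"
      by (subst sum.swap) (intro sum.cong refl sum.swap)
    show ?thesis by (subst swap3) (simp add: sum_distrib_left)
  qed
  also have "\<dots> = 0" by (simp add: curvature_annihilates_E[OF xy])
  finally show ?thesis .
qed

text \<open>The numerator of the flag curvature is g(V, R(V, y) y).\<close>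

lemma flag_curv_coord_eq_0:
  assumes xy: "x \<in> U" "y \<noteq> 0" and V: "curv_map x V y y = 0"
  shows "flag_curv_coord L x y V = 0"
proof -
  have "(\<Sum>i\<in>UNIV. \<Sum>j\<in>UNIV. \<Sum>k\<in>UNIV. \<Sum>l\<in>UNIV. V $ i * (y $ j * curv_low L j i k l x y * y $ l) * V $ k)
    = (\<Sum>i\<in>UNIV. V $ i * (\<Sum>s\<in>UNIV. fund L i s x y * curv_map x V y y $ s))"
  proof (rule sum.cong[OF refl])
    fix i
    have swap4: "(\<Sum>j\<in>UNIV. \<Sum>k\<in>UNIV. \<Sum>l\<in>UNIV. \<Sum>s\<in>UNIV. f j k l s) = (\<Sum>s\<in>UNIV. \<Sum>j\<in>UNIV. \<Sum>k\<in>UNIV. \<Sum>l\<in>UNIV. f j k l s)"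
      for f :: "'n \<Rightarrow> 'n \<Rightarrow> 'n \<Rightarrow> 'n \<Rightarrow> real"
      by (simp only: sum.swap[of "\<lambda>l s. f _ _ l s"] sum.swap[of "\<lambda>k s. \<Sum>l\<in>UNIV. f _ k l s"] sum.swap[of "\<lambda>j s. \<Sum>k\<in>UNIV. \<Sum>l\<in>UNIV. f j k l s"])
    have "(\<Sum>j\<in>UNIV. \<Sum>k\<in>UNIV. \<Sum>l\<in>UNIV. V $ i * (y $ j * curv_low L j i k l x y * y $ l) * V $ k)
      = (\<Sum>j\<in>UNIV. \<Sum>k\<in>UNIV. \<Sum>l\<in>UNIV. \<Sum>s\<in>UNIV. V $ i * (fund L i s x y * (y $ j * (curv_up L j s k l x base_vec * V $ k * y $ l))))"
      by (simp add: curv_low_def sum_distrib_left sum_distrib_right mult_ac curv_up_const[OF xy base_vec_nz])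
    also have "\<dots> = V $ i * (\<Sum>s\<in>UNIV. fund L i s x y * curv_map x V y y $ s)"
      by (subst swap4) (simp add: curv_map_def sum_distrib_left)
    finally show "(\<Sum>j\<in>UNIV. \<Sum>k\<in>UNIV. \<Sum>l\<in>UNIV. V $ i * (y $ j * curv_low L j i k l x y * y $ l) * V $ k)
      = V $ i * (\<Sum>s\<in>UNIV. fund L i s x y * curv_map x V y y $ s)" .
  qed
  then show ?thesis by (simp add: flag_curv_coord_def V)
qed

text \<open>The curvature operators \<open>R(V, y)\<close> are tangent to the unit sphere of \<open>E x\<close>; since \<open>V \<mapsto> R(V, y) y\<close> has
  kernel \<open>span {y}\<close> when the flag curvature does not vanish, they act transitively on it.\<close>

lemma E_quadratic:
  assumes n: "CARD('n) \<ge> 2" and x: "x \<in> U"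
    and flag: "\<And>y V. y \<noteq> 0 \<Longrightarrow> V \<notin> span {y} \<Longrightarrow>
      \<exists>a b. flag_curv_coord L x y (a *\<^sub>R y + b *\<^sub>R V) \<noteq> 0"
  shows "\<exists>q. bilinear q \<and> (\<forall>y. E x y = q y y)"
proof (rule quadratic_if_transitive[OF squared_norm_E[OF x] n])
  interpret squared_norm "E x" "\<lambda>y. frechet_derivative (E x) (at y)" by (rule squared_norm_E[OF x])
  fix y w :: "real^'n" assume y: "y \<noteq> 0"
  let ?D = "frechet_derivative (E x) (at y)"
  have D: "linear ?D" using linear_E'[OF y] .
  \<comment> \<open>The radial summand removes the kernel. Since \<open>?D\<close> kills every R(V,
    y) y and \<open>?D y = 2 E x y\<close> is positive, applying \<open>?D\<close> to
    \<open>T V = 0\<close> gives \<open>?D V = 0\<close> and then R(V, y) y = 0.\<close>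
  define T where "T V = curv_map x V y y + ?D V *\<^sub>R y" for V
  have T: "linear T"
    unfolding T_def
    by (rule linearI) (simp_all add: linear_add[OF D] linear_cmul[OF D] linear_add[OF linear_curv_map_direction]
        linear_cmul[OF linear_curv_map_direction] algebra_simps)
  have "inj T"
  proof (rule linear_injective_0[THEN iffD2, OF T, rule_format])
    fix V assume TV: "T V = 0"
    have "?D (T V) = ?D V * (2 * E x y)"
      by (simp add: T_def linear_add[OF D] linear_cmul[OF D] curv_map_invariant[OF x y] euler[OF y])
    then have DV: "?D V = 0" using TV pos[OF y] linear_0[OF D] by auto
    then have RV: "curv_map x V y y = 0" using TV by (simp add: T_def)
    \<comment> \<open>R(-, y) y vanishes on the whole plane of the flag, so the contradiction arises
      whichever vector of the plane the flag curvature is evaluated with.\<close>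
    have "curv_map x (a *\<^sub>R y + b *\<^sub>R V) y y = 0" for a b
      by (simp add: linear_add[OF linear_curv_map_direction] linear_cmul[OF linear_curv_map_direction] curv_map_same RV)
    then have "flag_curv_coord L x y (a *\<^sub>R y + b *\<^sub>R V) = 0" for a b
      by (rule flag_curv_coord_eq_0[OF x y])
    then have "V \<in> span {y}" using flag[OF y] by blast
    then obtain c where c: "V = c *\<^sub>R y" by (auto simp: span_singleton)
    then have "c * (2 * E x y) = 0" using DV by (simp add: linear_cmul[OF D] euler[OF y])
    then show "V = 0" using pos[OF y] c by simp
  qed
  then obtain V where V: "w = T V" using linear_injective_imp_surjective[OF T] by (metis surjD)
  show "\<exists>A c. linear A \<and> (\<forall>z. z \<noteq> 0 \<longrightarrow> frechet_derivative (E x) (at z) (A z) = 0) \<and> w = A y + c *\<^sub>R y"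
    by (rule exI[of _ "curv_map x V y"], rule exI[of _ "?D V"])
      (simp add: linear_curv_map curv_map_invariant[OF x] V T_def)
qed

end

section \<open>Berwald manifolds\<close>

lemma open_cmap_image:
  assumes "is_chart c" "open S" "S \<subseteq> cdom c" shows "open (cmap c ` S)"
proof -
  have "openin (top_of_set (cimg c)) (cmap c ` S)"
    using assms unfolding is_chart_def
    by (metis homeomorphism_imp_open_map openin_open_eq)
  then show ?thesis using assms(1) openin_open_trans unfolding is_chart_def by blast
qed

lemma cinv_cmap: "is_chart c \<Longrightarrow> p \<in> cdom c \<Longrightarrow> cinv c (cmap c p) = p"
  unfolding is_chart_def homeomorphism_def by blast

section \<open>Tangent spaces and flags in coordinates\<close>

locale smooth_atlas =
  fixes A :: "('m::{t2_space, second_countable_topology}, 'n::finite) chart set"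
  assumes smooth_structure: "smooth_structure A"
begin

lemma is_chart: "c \<in> A \<Longrightarrow> is_chart c"
  using smooth_structure by (simp add: smooth_structure_def)

lemma chart_exists: "\<exists>c. c \<in> A \<and> p \<in> cdom c"
  using smooth_structure unfolding smooth_structure_def by blast

lemma transition_differentiable:
  assumes "c \<in> A" "d \<in> A" "p \<in> cdom c" "p \<in> cdom d"
  shows "transition c d differentiable at (cmap c p)"
proof (rule smooth_on_differentiable)
  show "smooth_on (cmap c ` (cdom c \<inter> cdom d)) (transition c d)"
    using smooth_structure assms(1,2) unfolding smooth_structure_def compatible_def by blast
qed (use assms in blast)

lemma transition_at: "c \<in> A \<Longrightarrow> p \<in> cdom c \<Longrightarrow> transition c d (cmap c p) = cmap d p"
  by (simp add: transition_def cinv_cmap is_chart)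

lemma transition_refl:
  assumes "c \<in> A" "p \<in> cdom c"
  shows "frechet_derivative (transition c c) (at (cmap c p)) = (\<lambda>v. v)"
proof -
  have "open (cdom c)" using is_chart[OF assms(1)] by (simp add: is_chart_def)
  then have "frechet_derivative (transition c c) (at (cmap c p)) = frechet_derivative (\<lambda>x. x) (at (cmap c p))"
    by (intro frechet_derivative_cong_open[OF open_cmap_image[OF is_chart[OF assms(1)], of "cdom c"]])
      (use assms in \<open>auto simp: transition_at\<close>)
  then show ?thesis by simp
qed

lemma transition_chain:
  assumes A: "c \<in> A" "d \<in> A" "e \<in> A" and p: "p \<in> cdom c" "p \<in> cdom d" "p \<in> cdom e"
  shows "frechet_derivative (transition c e) (at (cmap c p)) v
    = frechet_derivative (transition d e) (at (cmap d p)) (frechet_derivative (transition c d) (at (cmap c p)) v)"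
proof -
  have "open (cdom c \<inter> cdom d)" using is_chart[OF A(1)] is_chart[OF A(2)] by (auto simp: is_chart_def)
  then have "frechet_derivative (transition c e) (at (cmap c p)) = frechet_derivative (transition d e \<circ> transition c d) (at (cmap c p))"
    by (intro frechet_derivative_cong_open[OF open_cmap_image[OF is_chart[OF A(1)], of "cdom c \<inter> cdom d"]])
      (use A p in \<open>auto simp: transition_at\<close>)
  also have "\<dots> = frechet_derivative (transition d e) (at (transition c d (cmap c p))) \<circ> frechet_derivative (transition c d) (at (cmap c p))"
    by (rule frechet_derivative_compose) (use A p in \<open>simp_all add: transition_at transition_differentiable\<close>)
  finally show ?thesis using A p by (simp add: transition_at)
qed

lemma tvec_of_in_tangent_space:
  assumes "c \<in> A" "p \<in> cdom c" shows "tvec_of A c p y \<in> tangent_space A p"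
  unfolding tangent_space_def mem_Collect_eq
proof (intro conjI allI ballI impI)
  fix d e assume "d \<in> A" "e \<in> A" "p \<in> cdom d \<and> p \<in> cdom e"
  then show "tvec_of A c p y e = frechet_derivative (transition d e) (at (cmap d p)) (tvec_of A c p y d)"
    using transition_chain[of c d e p y] assms by (simp add: tvec_of_def)
qed (auto simp: tvec_of_def)

lemma tvec_of_at: "c \<in> A \<Longrightarrow> p \<in> cdom c \<Longrightarrow> tvec_of A c p y c = y"
  by (simp add: tvec_of_def transition_refl)

lemma tvec_of_coordinates:
  assumes "c \<in> A" "p \<in> cdom c" "v \<in> tangent_space A p" shows "tvec_of A c p (v c) = v"
proof
  fix d
  show "tvec_of A c p (v c) d = v d"
  proof (cases "d \<in> A \<and> p \<in> cdom d")
    case True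
    then have "v d = frechet_derivative (transition c d) (at (cmap c p)) (v c)"
      using assms unfolding tangent_space_def by blast
    with True show ?thesis by (simp add: tvec_of_def)
  next
    case False
    then have "v d = 0" using assms(3) unfolding tangent_space_def by blast
    with False show ?thesis by (auto simp: tvec_of_def)
  qed
qed

lemma linear_tvec_of:
  assumes "c \<in> A" "p \<in> cdom c" shows "linear (tvec_of A c p)"
proof (rule linearI)
  fix u v :: "real^'n" and r :: real
  have lin: "linear (frechet_derivative (transition c d) (at (cmap c p)))" if "d \<in> A" "p \<in> cdom d" for d
    using transition_differentiable assms that linear_frechet_derivative by blast
  show "tvec_of A c p (u + v) = tvec_of A c p u + tvec_of A c p v"
    by (auto simp: tvec_of_def fun_eq_iff linear_add[OF lin])
  show "tvec_of A c p (r *\<^sub>R v) = r *\<^sub>R tvec_of A c p v"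
    by (auto simp: tvec_of_def fun_eq_iff scaleR_fun_def linear_cmul[OF lin])
qed

lemma tangent_space_add:
  assumes "u \<in> tangent_space A p" "v \<in> tangent_space A p" shows "u + v \<in> tangent_space A p"
proof -
  obtain c where c: "c \<in> A" "p \<in> cdom c" using chart_exists by blast
  have "u + v = tvec_of A c p (u c + v c)"
    by (simp add: linear_add[OF linear_tvec_of[OF c]] tvec_of_coordinates[OF c] assms)
  then show ?thesis using tvec_of_in_tangent_space[OF c] by metis
qed

lemma tangent_space_scale:
  assumes "v \<in> tangent_space A p" shows "r *\<^sub>R v \<in> tangent_space A p"
proof -
  obtain c where c: "c \<in> A" "p \<in> cdom c" using chart_exists by blast
  have "r *\<^sub>R v = tvec_of A c p (r *\<^sub>R v c)"
    by (simp add: linear_cmul[OF linear_tvec_of[OF c]] tvec_of_coordinates[OF c] assms)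
  then show ?thesis using tvec_of_in_tangent_space[OF c] by metis
qed

text \<open>Linearly independent coordinate vectors give a flag. The second conclusion shows that
  the choice of a transverse vector in \<open>flag_curvature\<close> is made from a nonempty
  set.\<close>

lemma is_flag_span:
  assumes c: "c \<in> A" "p \<in> cdom c" and y: "y \<noteq> 0" "V \<notin> span {y}"
  shows "is_flag A p (tvec_of A c p y) (span {tvec_of A c p y, tvec_of A c p V})"
    and "tvec_of A c p V \<notin> span {tvec_of A c p y}"
proof -
  let ?t = "tvec_of A c p"
  have inj: "u = v" if "?t u = ?t v" for u v using tvec_of_at[OF c] that by metis
  have "?t 0 = 0" by (rule linear_0[OF linear_tvec_of[OF c]])
  then have ty: "?t y \<noteq> 0" using inj y(1) by metis
  show V: "?t V \<notin> span {?t y}"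
  proof
    assume "?t V \<in> span {?t y}"
    then obtain k where "?t V = k *\<^sub>R ?t y" by (auto simp: span_singleton)
    then have "V = k *\<^sub>R y" using inj by (simp add: linear_cmul[OF linear_tvec_of[OF c], symmetric])
    then show False using y(2) by (auto simp: span_singleton)
  qed
  have "?t V \<noteq> ?t y" using V span_base[of "?t y" "{?t y}"] by auto
  have "independent {?t V, ?t y}"
    using V ty by (simp add: independent_insert dependent_single)
  then have "dim (span {?t V, ?t y}) = card {?t V, ?t y}"
    by (rule dim_span_eq_card_independent)
  then have "dim (span {?t y, ?t V}) = 2" using \<open>?t V \<noteq> ?t y\<close> by (simp add: insert_commute)
  moreover have "subspace (tangent_space A p)"
    unfolding subspace_def
    using tangent_space_add tangent_space_scale tvec_of_in_tangent_space[OF c, of 0] \<open>?t 0 = 0\<close> by metis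
  then have "span {?t y, ?t V} \<subseteq> tangent_space A p"
    by (intro span_minimal) (auto intro: tvec_of_in_tangent_space[OF c])
  ultimately show "is_flag A p (?t y) (span {?t y, ?t V})"
    using ty by (simp add: is_flag_def span_base)
qed

end

section \<open>The Riemannian metric of a Berwald manifold\<close>

locale berwald = smooth_atlas A
  for A :: "('m::{t2_space, second_countable_topology}, 'n::finite) chart set" +
  fixes F :: "'m \<Rightarrow> ('m, 'n) tvec \<Rightarrow> real"
  assumes berwald: "berwald_manifold A F"
begin

lemma finsler: "finsler_manifold A F"
  using berwald by (simp add: berwald_manifold_def)

lemmas F_nonneg = finsler[unfolded finsler_manifold_def, THEN conjunct2, THEN conjunct1, rule_format]
  and smooth_coord_expr = finsler[unfolded finsler_manifold_def, THEN conjunct2, THEN conjunct2, THEN conjunct1, rule_format]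
  and F_pos = finsler[unfolded finsler_manifold_def, THEN conjunct2, THEN conjunct2, THEN conjunct2, THEN conjunct1, rule_format]
  and F_hom = finsler[unfolded finsler_manifold_def, THEN conjunct2, THEN conjunct2, THEN conjunct2, THEN conjunct2,
      THEN conjunct1, rule_format]
  and fund_posdef = finsler[unfolded finsler_manifold_def, THEN conjunct2, THEN conjunct2, THEN conjunct2, THEN conjunct2,
      THEN conjunct2, rule_format]
  and chern_const = berwald[unfolded berwald_manifold_def, THEN conjunct2, rule_format]

lemma coord_expr_at: "c \<in> A \<Longrightarrow> p \<in> cdom c \<Longrightarrow> coord_expr A F c (cmap c p) y = F p (tvec_of A c p y)"
  by (simp add: coord_expr_def cinv_cmap is_chart)

lemma berwald_chart_coord_expr:
  assumes c: "c \<in> A" shows "berwald_chart (cimg c) (coord_expr A F c)"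
proof
  show "open (cimg c)" using is_chart[OF c] by (simp add: is_chart_def)
  show "smooth_field (cimg c) (coord_expr A F c)" by (rule smooth_coord_expr[OF c])
  fix x r and y z u :: "real^'n" and i j k :: 'n
  assume x: "x \<in> cimg c"
  then obtain p where p: "p \<in> cdom c" "x = cmap c p" by blast
  note tangent = tvec_of_in_tangent_space[OF c p(1)]
  show "coord_expr A F c x (r *\<^sub>R y) = r * coord_expr A F c x y" if "r > 0"
    by (simp add: p coord_expr_at[OF c p(1)] linear_cmul[OF linear_tvec_of[OF c p(1)]] F_hom[OF tangent that])
  show "coord_expr A F c x y > 0" if "y \<noteq> 0"
  proof -
    have "tvec_of A c p y \<noteq> 0" using tvec_of_at[OF c p(1), of y] that by auto
    then show ?thesis by (simp add: p coord_expr_at[OF c p(1)] F_pos[OF tangent])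
  qed
  show "u \<bullet> (fund_matrix (coord_expr A F c) x y *v u) > 0" if "y \<noteq> 0" "u \<noteq> 0"
    by (rule fund_posdef[OF c x that])
  show "chern (coord_expr A F c) i j k x y = chern (coord_expr A F c) i j k x z" if "y \<noteq> 0" "z \<noteq> 0"
    by (rule chern_const[OF c x conjI[OF that]])
qed

text \<open>\<open>flag_curvature\<close> is computed in a chart picked by the choice operator;
  taking \<open>c\<close> to be that very chart avoids any comparison of charts.\<close>

lemma squared_norm_quadratic:
  assumes n: "CARD('n) \<ge> 2"
    and flag: "\<And>y \<sigma>. is_flag A p y \<sigma> \<Longrightarrow> flag_curvature A F p y \<sigma> \<noteq> 0"
  obtains c q where "c \<in> A" "p \<in> cdom c" "bilinear q" "\<And>v. v \<in> tangent_space A p \<Longrightarrow> (F p v)\<^sup>2 = q (v c) (v c)"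
proof -
  define c where "c = (SOME c. c \<in> A \<and> p \<in> cdom c)"
  have c: "c \<in> A" "p \<in> cdom c"
    using someI_ex[OF chart_exists[of p]] by (auto simp: c_def)
  let ?L = "coord_expr A F c" and ?x = "cmap c p" and ?t = "tvec_of A c p"
  interpret berwald_chart "cimg c" ?L by (rule berwald_chart_coord_expr[OF c(1)])
  have "\<exists>a b. flag_curv_coord ?L ?x y (a *\<^sub>R y + b *\<^sub>R V) \<noteq> 0" if yV: "y \<noteq> 0" "V \<notin> span {y}" for y V
  proof -
    \<comment> \<open>The transverse vector picked by \<open>flag_curvature\<close>. All that is
      used about it is that it lies in the plane, so its coordinates are \<open>a y + b V\<close>
      for some \<open>a\<close> and \<open>b\<close>, as in the assumption of
      \<open>E_quadratic\<close>.\<close>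
    define W where "W = (SOME W. W \<in> span {?t y, ?t V} \<and> W \<notin> span {?t y})"
    have "\<exists>W. W \<in> span {?t y, ?t V} \<and> W \<notin> span {?t y}"
      using is_flag_span(2)[OF c yV] by (intro exI[of _ "?t V"]) (simp add: span_base)
    from someI_ex[OF this] have W: "W \<in> span {?t y, ?t V}" by (simp add: W_def)
    then obtain a where "W - a *\<^sub>R ?t y \<in> span {?t V}" by (auto simp: span_breakdown_eq)
    then obtain b where "W - a *\<^sub>R ?t y = b *\<^sub>R ?t V" by (auto simp: span_singleton)
    then have "W = a *\<^sub>R ?t y + b *\<^sub>R ?t V" by (simp add: diff_eq_eq add.commute)
    then have "W c = a *\<^sub>R y + b *\<^sub>R V"
      by (simp add: scaleR_fun_def tvec_of_at[OF c])
    moreover have "flag_curvature A F p (?t y) (span {?t y, ?t V}) = flag_curv_coord ?L ?x y (W c)"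
      by (simp add: flag_curvature_def Let_def W_def[symmetric] c_def[symmetric] tvec_of_at[OF c])
    ultimately show ?thesis using flag[OF is_flag_span(1)[OF c yV]] by metis
  qed
  then obtain q where q: "bilinear q" "\<And>y. E ?x y = q y y"
    using E_quadratic[OF n, of ?x] c(2) by blast
  have "(F p v)\<^sup>2 = q (v c) (v c)" if "v \<in> tangent_space A p" for v
    using q(2)[of "v c"] by (simp add: E_def coord_expr_at[OF c] tvec_of_coordinates[OF c that])
  then show ?thesis using that c q(1) by blast
qed

text \<open>Defined from \<open>F\<close> alone, without a chart. Subtraction is written with the
  factor \<open>-1\<close> so that smoothness of constants, sums and products suffices.\<close>

definition polarization :: "'m \<Rightarrow> ('m, 'n) tvec \<Rightarrow> ('m, 'n) tvec \<Rightarrow> real" where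
  "polarization p u v = 1/2 * ((F p (u + v))\<^sup>2 + (-1) * (F p u)\<^sup>2 + (-1) * (F p v)\<^sup>2)"

lemma polarization_self:
  assumes "v \<in> tangent_space A p" shows "polarization p v v = (F p v)\<^sup>2"
proof -
  have "F p (v + v) = 2 * F p v" using F_hom[OF assms, of 2] by (simp add: scaleR_2)
  then show ?thesis by (simp add: polarization_def power_mult_distrib)
qed

text \<open>The coordinate vectors and their pairwise sums are fixed and nonzero, so only values of
  \<open>F\<close> off the zero section enter.\<close>

lemma smooth_polarization:
  assumes c: "c \<in> A"
  shows "smooth_on (cimg c) (\<lambda>x. polarization (cinv c x) (tvec_of A c (cinv c x) (axis i 1)) (tvec_of A c (cinv c x) (axis j 1)))"
proof -
  let ?L = "coord_expr A F c"
  have op: "open (cimg c)" using is_chart[OF c] by (simp add: is_chart_def)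
  have slice: "smooth_on (cimg c) (\<lambda>x. (?L x y)\<^sup>2)" if "y \<noteq> 0" for y
    using smooth_on_slice[OF op smooth_coord_expr[OF c], of y] that by (intro smooth_on_power2[OF op]) simp
  have nz: "axis i 1 + axis j 1 \<noteq> (0 :: real^'n)"
    by (auto simp: vec_eq_iff axis_def intro!: exI[of _ i])
  have "smooth_on (cimg c) (\<lambda>x. 1/2 * ((?L x (axis i 1 + axis j 1))\<^sup>2 + (-1) * (?L x (axis i 1))\<^sup>2 + (-1) * (?L x (axis j 1))\<^sup>2))"
    by (intro smooth_on_mult smooth_on_add smooth_on_const slice op nz) (simp_all add: axis_eq_0_iff)
  then show ?thesis
  proof (rule smooth_on_cong[OF op, rotated])
    fix x assume "x \<in> cimg c"
    then obtain p where p: "p \<in> cdom c" "x = cmap c p" by blast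
    show "1/2 * ((?L x (axis i 1 + axis j 1))\<^sup>2 + (-1) * (?L x (axis i 1))\<^sup>2 + (-1) * (?L x (axis j 1))\<^sup>2)
      = polarization (cinv c x) (tvec_of A c (cinv c x) (axis i 1)) (tvec_of A c (cinv c x) (axis j 1))"
      by (simp add: p cinv_cmap[OF is_chart[OF c] p(1)] coord_expr_at[OF c p(1)] polarization_def
          linear_add[OF linear_tvec_of[OF c p(1)]])
  qed
qed

lemma riemannian_metric_polarization:
  assumes n: "CARD('n) \<ge> 2"
    and flag: "\<And>p y \<sigma>. is_flag A p y \<sigma> \<Longrightarrow> flag_curvature A F p y \<sigma> \<noteq> 0"
  shows "riemannian_metric A polarization"
  unfolding riemannian_metric_def
proof (intro conjI allI ballI impI)
  fix p u v w and a b :: real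
  assume T: "u \<in> tangent_space A p" "v \<in> tangent_space A p" "w \<in> tangent_space A p"
  obtain c q where cq: "c \<in> A" "p \<in> cdom c" "bilinear q"
    "\<And>v. v \<in> tangent_space A p \<Longrightarrow> (F p v)\<^sup>2 = q (v c) (v c)"
    using squared_norm_quadratic[OF n flag] by blast
  \<comment> \<open>\<open>q\<close> need not be symmetric; polarization returns its symmetrization.
    Bilinearity concerns one point at a time, so a chart and a \<open>q\<close> depending on
    \<open>p\<close> suffice.\<close>
  have q: "polarization p u v = 1/2 * (q (u c) (v c) + q (v c) (u c))"
    if "u \<in> tangent_space A p" "v \<in> tangent_space A p" for u v
    using that
    by (simp add: polarization_def cq(4) tangent_space_add bilinear_ladd[OF cq(3)] bilinear_radd[OF cq(3)])
  show "polarization p (a *\<^sub>R u + b *\<^sub>R v) w = a * polarization p u w + b * polarization p v w"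
  proof -
    have "(a *\<^sub>R u + b *\<^sub>R v) c = a *\<^sub>R u c + b *\<^sub>R v c" by (simp add: scaleR_fun_def)
    then show ?thesis
      using T by (simp only: q tangent_space_add tangent_space_scale bilinear_ladd[OF cq(3)] bilinear_radd[OF cq(3)]
          bilinear_lmul[OF cq(3)] bilinear_rmul[OF cq(3)]) (simp add: algebra_simps)
  qed
next
  fix p u v
  show "polarization p u v = polarization p v u" by (simp add: polarization_def add.commute)
next
  fix p v assume v: "v \<in> tangent_space A p" "v \<noteq> 0"
  show "polarization p v v > 0" using F_pos[OF v] by (simp add: polarization_self[OF v(1)])
next
  fix c i j assume "c \<in> A"
  then show "smooth_on (cimg c) (\<lambda>x. polarization (cinv c x) (tvec_of A c (cinv c x) (axis i 1)) (tvec_of A c (cinv c x) (axis j 1)))"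
    by (rule smooth_polarization)
qed

end

theorem theorem1p1:
  fixes A :: "('m::{t2_space, second_countable_topology}, 'n::finite) chart set"
    and F :: "'m \<Rightarrow> ('m, 'n) tvec \<Rightarrow> real"
  assumes "CARD('n) \<ge> 2"
    and "berwald_manifold A F"
    and "geodesically_complete A F"
    and "\<And>p y \<sigma>. is_flag A p y \<sigma> \<Longrightarrow> flag_curvature A F p y \<sigma> \<noteq> 0"
  shows "\<exists>h. riemannian_metric A h \<and>
           (\<forall>p. \<forall>v\<in>tangent_space A p. F p v = sqrt (h p v v))"
proof -
  interpret berwald A F
    using assms(2) by unfold_locales (auto simp: berwald_manifold_def finsler_manifold_def)
  have "F p v = sqrt (polarization p v v)" if "v \<in> tangent_space A p" for p v
    using F_nonneg[OF that] by (simp add: polarization_self[OF that])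
  then show ?thesis
    using riemannian_metric_polarization[OF assms(1,4)] by blast
qed

end
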